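(* Let $(G,\mathcal{P})$ be a Poisson-Lie group with Lie algebra $\mathfrak{g}$, let $\Sigma$ be a $2$-dimensional orientable smooth manifold, and let $(X,A): T\Sigma \to T^{*}G$ be a vector bundle map over $X:\Sigma\to G$. Let $\tilde A$ be the associated $\mathfrak{g}^{*}$-valued $1$-form on $\Sigma$, let $\Theta_R^X = X^{*}(\Theta_R)$ be the pullback of the right-invariant Maurer-Cartan form of $G$, and let $\Pi(g):\mathfrak{g}^{*}\to\mathfrak{g}$ be the linear map induced by $\mathcal{P}$ at $g \in G$. Then the equations of motion of the Poisson-Lie sigma model for $(X,A)$, namely (in any local coordinates $(y^1,\dots,y^n)$ on $G$) $$dX^{\alpha} + \mathcal{P}^{\alpha\gamma}(X)\, A_{\gamma} = 0,\qquad dA_{\alpha} + \tfrac12\, \frac{\partial \mathcal{P}^{\beta\gamma}}{\partial y^{\alpha}}(X)\, A_{\beta}\wedge A_{\gamma} = 0,$$ can be equivalently written in the coordinate-free form $$\Theta_R^{X} = \Pi(X)(\tilde A),\qquad d\tilde A + \tfrac12 [\tilde A\wedge\tilde A]_{\mathfrak{g}^{*}} = 0,$$ where $\Pi(X)$ denotes, at $p\in\Sigma$, the map $\Pi(g)$ with $g = X(p)$.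
   Context: Everything is smooth and the summation convention is used. A Poisson-Lie group is a Lie group $G$ with a Poisson bivector field $\mathcal{P}$ such that the multiplication $G\times G\to G$ is a Poisson map; equivalently $\mathcal{P}$ is multiplicative: $\mathcal{P}(gh)=L_{g*}(\mathcal{P}(h))+R_{h*}(\mathcal{P}(g))$ for all $g,h\in G$, where $L_g,R_h$ are left and right translations. A vector bundle map $(X,A):T\Sigma\to T^{*}G$ consists of a smooth map $X:\Sigma\to G$ and a smooth map $A:T\Sigma\to T^{*}G$ covering $X$ and linear on fibres; so $A$ restricts to linear maps $T_p\Sigma\to T^{*}_{X(p)}G$, and is regarded as a $1$-form on $\Sigma$ with values in sections of $X^{*}(T^{*}G)$. In local coordinates $(y^1,\dots,y^n)$ on an open set $U\subset G$, one writes on $X^{-1}(U)$: $A = A_{\alpha}\,dy^{\alpha}$ (with $A_\alpha$ ordinary $1$-forms, $A(p)=A_\alpha(p)\,dy^\alpha|_{X(p)}$), $dX^{\alpha}=X^{*}(dy^{\alpha})$, $\mathcal{P}^{\alpha\beta}=\mathcal{P}(dy^{\alpha},dy^{\beta})$. The equations of motion in local coordinates are required for all coordinate charts. The Lie algebra $\mathfrak{g}=T_eG$ has its usual bracket (of left-invariant vector fields). For $T\in\mathfrak{g}$, $R_T(g)=R_{g*}(T)$ is the right-invariant vector field. For $\xi\in\mathfrak{g}^{*}$, $R_{\xi}(g)=R_{g^{-1}}^{*}(\xi)\in T_g^{*}G$ is the right-invariant $1$-form. Fix a basis $(T_k)_{k=1}^n$ of $\mathfrak{g}$ with dual basis $(T^k)$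 of $\mathfrak{g}^{*}$. One expands $A = A_k R_{T^k}$ with $A_k\in\Omega^1(\Sigma)$, i.e. $A(p)=A_k(p)\,R_{T^k}(X(p))$, and defines the $\mathfrak{g}^{*}$-valued $1$-form $\tilde A := A_k T^k$ (independent of the basis). The right-invariant Maurer-Cartan form is $\Theta_R(g)=R_{T^k}(g)\,T_k$, and $\Theta_R^X:=X^{*}(\Theta_R)$, a $\mathfrak{g}$-valued $1$-form on $\Sigma$. For $g\in G$ the linear map $\Pi(g):\mathfrak{g}^{*}\to\mathfrak{g}$ is defined by $\langle\eta,\Pi(g)(\xi)\rangle := \langle\mathcal{P}(g),R_{\xi}(g)\otimes R_{\eta}(g)\rangle$ for all $\xi,\eta\in\mathfrak{g}^{*}$. The Lie bracket $[\cdot,\cdot]_{\mathfrak{g}^{*}}$ on $\mathfrak{g}^{*}$ is the one induced by $\mathcal{P}$: the intrinsic derivative $D\mathcal{P}:\mathfrak{g}\to\mathfrak{g}\otimes\mathfrak{g}$ is $D\mathcal{P}(Z):=[\mathcal{L}_{\bar Z}(\mathcal{P})](e)$, with $\bar Z$ any vector field on $G$ with value $Z$ at $e$, and $[\cdot,\cdot]_{\mathfrak{g}^{*}}$ is its transpose $(D\mathcal{P})^{*}:\mathfrak{g}^{*}\otimes\mathfrak{g}^{*}\to\mathfrak{g}^{*}$; that is, if $D\mathcal{P}(T_k)={f^{ij}}_k\,T_i\otimes T_j$ then $[T^i,T^j]_{\mathfrak{g}^{*}}={f^{ij}}_k T^k$. The notation $[\tilde A\wedge\tilde A]_{\mathfrak{g}^{*}}$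 means $(A_i\wedge A_j)\,[T^i,T^j]_{\mathfrak{g}^{*}}$. *)

theory Defs
  imports "HOL-Analysis.Analysis"
begin

text \<open>\<open>C\<^sup>k\<close> maps; meant for open \<open>S\<close>, since the derivatives are full derivatives.\<close>

primrec Ck_on :: "nat \<Rightarrow> ('a::real_normed_vector \<Rightarrow> 'b::real_normed_vector) \<Rightarrow> 'a set \<Rightarrow> bool" where
  "Ck_on 0 f S \<longleftrightarrow> continuous_on S f"
| "Ck_on (Suc k) f S \<longleftrightarrow>
     (\<forall>x\<in>S. f differentiable (at x)) \<and> (\<forall>v. Ck_on k (\<lambda>x. frechet_derivative f (at x) v) S)"

definition smooth_on :: "('a::real_normed_vector \<Rightarrow> 'b::real_normed_vector) \<Rightarrow> 'a set \<Rightarrow> bool" where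
  "smooth_on f S \<longleftrightarrow> (\<forall>k. Ck_on k f S)"

text \<open>A chart is a pair \<open>(U, \<phi>)\<close>; the values of \<open>\<phi>\<close> outside \<open>U\<close> are irrelevant.
  A manifold is a Hausdorff, second countable type (sorts at the point of use)
  together with a maximal smooth atlas.\<close>

type_synonym ('m, 'e) chart = "'m set \<times> ('m \<Rightarrow> 'e)"

abbreviation chart_inv :: "('m, 'e) chart \<Rightarrow> 'e \<Rightarrow> 'm" where
  "chart_inv c \<equiv> inv_into (fst c) (snd c)"

definition is_chart :: "('m::topological_space, 'e::euclidean_space) chart \<Rightarrow> bool" where
  "is_chart c \<longleftrightarrow> open (fst c) \<and> open (snd c ` fst c) \<and>
     homeomorphism (fst c) (snd c ` fst c) (snd c) (chart_inv c)"

definition smooth_transition ::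
    "('m, 'e::euclidean_space) chart \<Rightarrow> ('m, 'e) chart \<Rightarrow> bool" where
  "smooth_transition c d \<longleftrightarrow> smooth_on (snd d \<circ> chart_inv c) (snd c ` (fst c \<inter> fst d))"

definition smooth_atlas :: "('m::topological_space, 'e::euclidean_space) chart set \<Rightarrow> bool" where
  "smooth_atlas \<A> \<longleftrightarrow> (\<forall>c\<in>\<A>. is_chart c) \<and> (\<Union>c\<in>\<A>. fst c) = UNIV \<and>
     (\<forall>c\<in>\<A>. \<forall>d\<in>\<A>. smooth_transition c d)"

definition smooth_structure :: "('m::topological_space, 'e::euclidean_space) chart set \<Rightarrow> bool" where
  "smooth_structure \<A> \<longleftrightarrow> smooth_atlas \<A> \<and>
     (\<forall>c. is_chart c \<and> (\<forall>d\<in>\<A>. smooth_transition c d \<and> smooth_transition d c) \<longrightarrow> c \<in> \<A>)"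

definition orientable :: "('m::topological_space, real^'n) chart set \<Rightarrow> bool" where
  "orientable \<A> \<longleftrightarrow> (\<exists>\<B>\<subseteq>\<A>. (\<Union>c\<in>\<B>. fst c) = UNIV \<and>
     (\<forall>c\<in>\<B>. \<forall>d\<in>\<B>. \<forall>p\<in>fst c \<inter> fst d.
        det (matrix (frechet_derivative (snd d \<circ> chart_inv c) (at (snd c p)))) > 0))"

definition product_atlas :: "('m, 'e) chart set \<Rightarrow> ('n, 'f) chart set \<Rightarrow> ('m \<times> 'n, 'e \<times> 'f) chart set" where
  "product_atlas \<A> \<B> = {(fst c \<times> fst d, map_prod (snd c) (snd d)) | c d. c \<in> \<A> \<and> d \<in> \<B>}"

definition smooth_map ::
    "('m::topological_space, 'e::euclidean_space) chart set \<Rightarrow>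
     ('n::topological_space, 'f::euclidean_space) chart set \<Rightarrow> ('m \<Rightarrow> 'n) \<Rightarrow> bool" where
  "smooth_map \<A> \<B> f \<longleftrightarrow> continuous_on UNIV f \<and>
     (\<forall>c\<in>\<A>. \<forall>d\<in>\<B>. smooth_on (snd d \<circ> f \<circ> chart_inv c) (snd c ` (fst c \<inter> f -` fst d)))"

definition smooth_function ::
    "('m, 'e::euclidean_space) chart set \<Rightarrow> ('m \<Rightarrow> real) \<Rightarrow> bool" where
  "smooth_function \<A> f \<longleftrightarrow> (\<forall>c\<in>\<A>. smooth_on (f \<circ> chart_inv c) (snd c ` fst c))"

text \<open>Every point \<open>p\<close> has a preferred chart \<open>chart_at \<A> p\<close>, and the tangent space at \<open>p\<close> is the
  model space \<open>'e\<close>: a tangent vector is stored as its components in the preferred chart.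
  The cotangent space at \<open>p\<close> is the dual of \<open>'e\<close>. Since the preferred chart changes
  with \<open>p\<close> without any continuity, smoothness of fields is never a condition on the
  stored components; it is always expressed in a fixed chart.\<close>

type_synonym 'e covector = "'e \<Rightarrow>\<^sub>L real"

definition chart_at :: "('m, 'e) chart set \<Rightarrow> 'm \<Rightarrow> ('m, 'e) chart" where
  "chart_at \<A> p = (SOME c. c \<in> \<A> \<and> p \<in> fst c)"

definition differential ::
    "('m, 'e::euclidean_space) chart set \<Rightarrow> ('m \<Rightarrow> 'v::real_normed_vector) \<Rightarrow> 'm \<Rightarrow> 'e \<Rightarrow>\<^sub>L 'v" where
  "differential \<A> f p =
     (let c = chart_at \<A> p in Blinfun (frechet_derivative (f \<circ> chart_inv c) (at (snd c p))))"

definition tangent_map ::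
    "('m, 'e::euclidean_space) chart set \<Rightarrow> ('n, 'f::euclidean_space) chart set \<Rightarrow>
     ('m \<Rightarrow> 'n) \<Rightarrow> 'm \<Rightarrow> 'e \<Rightarrow>\<^sub>L 'f" where
  "tangent_map \<A> \<B> f p = differential \<A> (snd (chart_at \<B> (f p)) \<circ> f) p"

text \<open>The tangent vector at \<open>p\<close> whose components in the chart \<open>c\<close> are \<open>w\<close>.\<close>

definition tangent_of_coords ::
    "('m, 'e::euclidean_space) chart set \<Rightarrow> ('m, 'e) chart \<Rightarrow> 'm \<Rightarrow> 'e \<Rightarrow> 'e" where
  "tangent_of_coords \<A> c p = inv (blinfun_apply (differential \<A> (snd c) p))"

text \<open>The coordinate covector \<open>dy\<^sup>\<alpha>\<close> at \<open>q\<close>, for a chart \<open>c = (U, y)\<close>.\<close>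

definition dy :: "('m, real^'n) chart set \<Rightarrow> ('m, real^'n) chart \<Rightarrow> 'm \<Rightarrow> 'n \<Rightarrow> (real^'n) covector" where
  "dy \<A> c q \<alpha> = differential \<A> (\<lambda>x. snd c x $ \<alpha>) q"

definition partial_deriv ::
    "('m, real^'n) chart \<Rightarrow> 'n \<Rightarrow> ('m \<Rightarrow> real) \<Rightarrow> 'm \<Rightarrow> real" where
  "partial_deriv c \<alpha> f q = frechet_derivative (f \<circ> chart_inv c) (at (snd c q)) (axis \<alpha> 1)"

text \<open>The coefficients of a covector with respect to a basis \<open>\<theta>\<close> of the cotangent space.\<close>

definition covector_coeffs :: "('n \<Rightarrow> (real^'n) covector) \<Rightarrow> (real^'n) covector \<Rightarrow> real^'n" where
  "covector_coeffs \<theta> \<xi> = (THE a. \<xi> = (\<Sum>k\<in>UNIV. (a $ k) *\<^sub>R \<theta> k))"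

definition smooth_vector_field :: "('m, real^'n) chart set \<Rightarrow> ('m \<Rightarrow> real^'n) \<Rightarrow> bool" where
  "smooth_vector_field \<A> V \<longleftrightarrow> (\<forall>c\<in>\<A>. \<forall>\<alpha>. smooth_on
     ((\<lambda>q. blinfun_apply (dy \<A> c q \<alpha>) (V q)) \<circ> chart_inv c) (snd c ` fst c))"

text \<open>A form of degree one with values in \<open>'v\<close> maps each point to a linear map on the tangent
  space. Its exterior derivative
  \<open>d\<omega>(u, v) = \<Sum> (\<partial>\<^sub>i \<omega>\<^sub>j - \<partial>\<^sub>j \<omega>\<^sub>i) u\<^sup>i v\<^sup>j\<close> at \<open>p\<close> is computed in the chart \<open>chart_at \<A> p\<close>,
  where the components of tangent vectors at \<open>p\<close> are the vectors themselves.\<close>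

definition ext_deriv ::
    "('m, 'e::euclidean_space) chart set \<Rightarrow> ('m \<Rightarrow> 'e \<Rightarrow> 'v::real_normed_vector) \<Rightarrow> 'm \<Rightarrow> 'e \<Rightarrow> 'e \<Rightarrow> 'v" where
  "ext_deriv \<A> \<omega> p u v =
     (let c = chart_at \<A> p;
          \<omega>loc = (\<lambda>w x. \<omega> (chart_inv c x) (tangent_of_coords \<A> c (chart_inv c x) w))
      in frechet_derivative (\<omega>loc v) (at (snd c p)) u - frechet_derivative (\<omega>loc u) (at (snd c p)) v)"

definition wedge :: "('m \<Rightarrow> 'e \<Rightarrow> real) \<Rightarrow> ('m \<Rightarrow> 'e \<Rightarrow> real) \<Rightarrow> 'm \<Rightarrow> 'e \<Rightarrow> 'e \<Rightarrow> real" where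
  "wedge \<omega> \<eta> p u v = \<omega> p u * \<eta> p v - \<omega> p v * \<eta> p u"

text \<open>Elements of the tensor square of a tangent space are represented by the corresponding
  bilinear forms on the cotangent space.\<close>

type_synonym 'e bivector = "'e covector \<Rightarrow> 'e covector \<Rightarrow> real"

text \<open>\<open>P\<^sup>\<alpha>\<^sup>\<beta>\<close> in the chart \<open>c\<close>.\<close>

definition bivector_comp ::
    "('g, real^'n) chart set \<Rightarrow> ('g \<Rightarrow> (real^'n) bivector) \<Rightarrow> ('g, real^'n) chart \<Rightarrow> 'n \<Rightarrow> 'n \<Rightarrow> 'g \<Rightarrow> real" where
  "bivector_comp \<G> P c \<alpha> \<beta> q = P q (dy \<G> c q \<alpha>) (dy \<G> c q \<beta>)"

definition smooth_bivector_field ::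
    "('g, real^'n) chart set \<Rightarrow> ('g \<Rightarrow> (real^'n) bivector) \<Rightarrow> bool" where
  "smooth_bivector_field \<G> P \<longleftrightarrow>
     (\<forall>q. bilinear (P q) \<and> (\<forall>\<xi> \<eta>. P q \<xi> \<eta> = - P q \<eta> \<xi>)) \<and>
     (\<forall>c\<in>\<G>. \<forall>\<alpha> \<beta>. smooth_on (bivector_comp \<G> P c \<alpha> \<beta> \<circ> chart_inv c) (snd c ` fst c))"

definition poisson_bracket ::
    "('g, real^'n) chart set \<Rightarrow> ('g \<Rightarrow> (real^'n) bivector) \<Rightarrow> ('g \<Rightarrow> real) \<Rightarrow> ('g \<Rightarrow> real) \<Rightarrow> 'g \<Rightarrow> real" where
  "poisson_bracket \<G> P f h q = P q (differential \<G> f q) (differential \<G> h q)"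

definition poisson_bivector ::
    "('g, real^'n) chart set \<Rightarrow> ('g \<Rightarrow> (real^'n) bivector) \<Rightarrow> bool" where
  "poisson_bivector \<G> P \<longleftrightarrow> smooth_bivector_field \<G> P \<and>
     (\<forall>f1 f2 f3. smooth_function \<G> f1 \<and> smooth_function \<G> f2 \<and> smooth_function \<G> f3 \<longrightarrow>
       (\<forall>q. poisson_bracket \<G> P f1 (poisson_bracket \<G> P f2 f3) q
          + poisson_bracket \<G> P f2 (poisson_bracket \<G> P f3 f1) q
          + poisson_bracket \<G> P f3 (poisson_bracket \<G> P f1 f2) q = 0))"

definition lie_group ::
    "('g::topological_space, real^'n) chart set \<Rightarrow> ('g \<Rightarrow> 'g \<Rightarrow> 'g) \<Rightarrow> 'g \<Rightarrow> ('g \<Rightarrow> 'g) \<Rightarrow> bool" where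
  "lie_group \<G> gmult e ginv \<longleftrightarrow> smooth_structure \<G> \<and> group gmult e ginv \<and>
     smooth_map (product_atlas \<G> \<G>) \<G> (\<lambda>(g, h). gmult g h) \<and> smooth_map \<G> \<G> ginv"

definition push_bivector ::
    "((real^'n) \<Rightarrow>\<^sub>L (real^'n)) \<Rightarrow> (real^'n) bivector \<Rightarrow> (real^'n) bivector" where
  "push_bivector F B \<xi> \<eta> = B (\<xi> o\<^sub>L F) (\<eta> o\<^sub>L F)"

definition poisson_lie_group ::
    "('g::topological_space, real^'n) chart set \<Rightarrow> ('g \<Rightarrow> 'g \<Rightarrow> 'g) \<Rightarrow> 'g \<Rightarrow> ('g \<Rightarrow> 'g) \<Rightarrow>
     ('g \<Rightarrow> (real^'n) bivector) \<Rightarrow> bool" where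
  "poisson_lie_group \<G> gmult e ginv P \<longleftrightarrow> lie_group \<G> gmult e ginv \<and> poisson_bivector \<G> P \<and>
     (\<forall>g h \<xi> \<eta>. P (gmult g h) \<xi> \<eta> =
        push_bivector (tangent_map \<G> \<G> (\<lambda>x. gmult g x) h) (P h) \<xi> \<eta> +
        push_bivector (tangent_map \<G> \<G> (\<lambda>x. gmult x h) g) (P g) \<xi> \<eta>)"

text \<open>The Lie algebra is the tangent space \<open>real^'n\<close> at \<open>e\<close>, its dual is \<open>(real^'n) covector\<close>.\<close>

definition basis_of_lie_algebra :: "('n \<Rightarrow> real^'n) \<Rightarrow> bool" where
  "basis_of_lie_algebra T \<longleftrightarrow> inj T \<and> independent (range T) \<and> span (range T) = UNIV"

definition dual_basis :: "('n \<Rightarrow> real^'n) \<Rightarrow> 'n \<Rightarrow> (real^'n) covector" where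
  "dual_basis T k = (THE \<xi>. \<forall>j. blinfun_apply \<xi> (T j) = (if j = k then 1 else 0))"

text \<open>The right-invariant form \<open>R\<^sub>\<xi>(g)\<close>; right translation by \<open>ginv g\<close> maps \<open>g\<close> to \<open>e\<close>.\<close>

definition right_inv_form ::
    "('g, real^'n) chart set \<Rightarrow> ('g \<Rightarrow> 'g \<Rightarrow> 'g) \<Rightarrow> ('g \<Rightarrow> 'g) \<Rightarrow> (real^'n) covector \<Rightarrow> 'g \<Rightarrow> (real^'n) covector" where
  "right_inv_form \<G> gmult ginv \<xi> g = \<xi> o\<^sub>L tangent_map \<G> \<G> (\<lambda>x. gmult x (ginv g)) g"

definition Pi_map ::
    "('g, real^'n) chart set \<Rightarrow> ('g \<Rightarrow> 'g \<Rightarrow> 'g) \<Rightarrow> ('g \<Rightarrow> 'g) \<Rightarrow> ('g \<Rightarrow> (real^'n) bivector) \<Rightarrow>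
     'g \<Rightarrow> (real^'n) covector \<Rightarrow> real^'n" where
  "Pi_map \<G> gmult ginv P g \<xi> = (THE Z. \<forall>\<eta>. blinfun_apply \<eta> Z =
     P g (right_inv_form \<G> gmult ginv \<xi> g) (right_inv_form \<G> gmult ginv \<eta> g))"

definition maurer_cartan_right ::
    "('g, real^'n) chart set \<Rightarrow> ('g \<Rightarrow> 'g \<Rightarrow> 'g) \<Rightarrow> ('g \<Rightarrow> 'g) \<Rightarrow> ('n \<Rightarrow> real^'n) \<Rightarrow>
     'g \<Rightarrow> real^'n \<Rightarrow> real^'n" where
  "maurer_cartan_right \<G> gmult ginv T g w =
     (\<Sum>k\<in>UNIV. blinfun_apply (right_inv_form \<G> gmult ginv (dual_basis T k) g) w *\<^sub>R T k)"

text \<open>The Lie derivative of a bivector field \<open>P\<close> along \<open>V\<close>,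
  \<open>(L\<^sub>V P)\<^sup>\<beta>\<^sup>\<gamma> = V\<^sup>\<delta> \<partial>\<^sub>\<delta> P\<^sup>\<beta>\<^sup>\<gamma> - P\<^sup>\<delta>\<^sup>\<gamma> \<partial>\<^sub>\<delta> V\<^sup>\<beta> - P\<^sup>\<beta>\<^sup>\<delta> \<partial>\<^sub>\<delta> V\<^sup>\<gamma>\<close>,
  evaluated at \<open>q\<close> in the chart \<open>chart_at \<G> q\<close>, where the coordinate vectors at \<open>q\<close> are the
  standard basis vectors.\<close>

definition lie_derivative_bivector ::
    "('g, real^'n) chart set \<Rightarrow> ('g \<Rightarrow> real^'n) \<Rightarrow> ('g \<Rightarrow> (real^'n) bivector) \<Rightarrow> 'g \<Rightarrow> (real^'n) bivector" where
  "lie_derivative_bivector \<G> V P q \<xi> \<eta> =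
     (let c = chart_at \<G> q;
          Vc = (\<lambda>\<alpha> x. blinfun_apply (dy \<G> c x \<alpha>) (V x));
          Pc = bivector_comp \<G> P c
      in \<Sum>\<beta>\<in>UNIV. \<Sum>\<gamma>\<in>UNIV.
           (\<Sum>\<delta>\<in>UNIV. Vc \<delta> q * partial_deriv c \<delta> (Pc \<beta> \<gamma>) q
                     - Pc \<delta> \<gamma> q * partial_deriv c \<delta> (Vc \<beta>) q
                     - Pc \<beta> \<delta> q * partial_deriv c \<delta> (Vc \<gamma>) q)
           * blinfun_apply \<xi> (axis \<beta> 1) * blinfun_apply \<eta> (axis \<gamma> 1))"

text \<open>\<open>DP(Z)\<close>: the common value at \<open>e\<close> of the Lie derivatives of \<open>P\<close> along all smooth vector fields
  extending \<open>Z\<close>.\<close>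

definition intrinsic_derivative ::
    "('g, real^'n) chart set \<Rightarrow> 'g \<Rightarrow> ('g \<Rightarrow> (real^'n) bivector) \<Rightarrow> real^'n \<Rightarrow> (real^'n) bivector" where
  "intrinsic_derivative \<G> e P Z =
     (THE B. \<forall>V. smooth_vector_field \<G> V \<and> V e = Z \<longrightarrow> lie_derivative_bivector \<G> V P e = B)"

definition dual_bracket ::
    "('g, real^'n) chart set \<Rightarrow> 'g \<Rightarrow> ('g \<Rightarrow> (real^'n) bivector) \<Rightarrow>
     (real^'n) covector \<Rightarrow> (real^'n) covector \<Rightarrow> (real^'n) covector" where
  "dual_bracket \<G> e P \<xi> \<eta> = Blinfun (\<lambda>Z. intrinsic_derivative \<G> e P Z \<xi> \<eta>)"

text \<open>Smoothness of the total map between the tangent bundle and the cotangent bundle is smoothness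
  in the induced bundle charts; the base component is covered by smoothness of \<open>X\<close>.\<close>

definition vector_bundle_map ::
    "('s::topological_space, 'e::euclidean_space) chart set \<Rightarrow> ('g::topological_space, real^'n) chart set \<Rightarrow>
     ('s \<Rightarrow> 'g) \<Rightarrow> ('s \<Rightarrow> 'e \<Rightarrow> (real^'n) covector) \<Rightarrow> bool" where
  "vector_bundle_map \<S> \<G> X A \<longleftrightarrow> smooth_map \<S> \<G> X \<and> (\<forall>p. linear (A p)) \<and>
     (\<forall>c\<in>\<S>. \<forall>d\<in>\<G>. smooth_on
        (\<lambda>(x, w). let p = chart_inv c x
                  in covector_coeffs (dy \<G> d (X p)) (A p (tangent_of_coords \<S> c p w)))
        ((snd c ` (fst c \<inter> X -` fst d)) \<times> UNIV))"

text \<open>The forms \<open>dX\<^sup>\<alpha> = X\<^sup>*(dy\<^sup>\<alpha>)\<close> and \<open>A\<^sub>\<alpha>\<close> (defined by \<open>A = A\<^sub>\<alpha> dy\<^sup>\<alpha>\<close>) belonging to a chart \<open>c\<close>;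
  they are meaningful on \<open>X -` fst c\<close>.\<close>

definition dX ::
    "('s, 'e::euclidean_space) chart set \<Rightarrow> ('g, real^'n) chart set \<Rightarrow> ('s \<Rightarrow> 'g) \<Rightarrow>
     ('g, real^'n) chart \<Rightarrow> 'n \<Rightarrow> 's \<Rightarrow> 'e \<Rightarrow> real" where
  "dX \<S> \<G> X c \<alpha> p v = blinfun_apply (dy \<G> c (X p) \<alpha>) (blinfun_apply (tangent_map \<S> \<G> X p) v)"

definition A_local ::
    "('g, real^'n) chart set \<Rightarrow> ('s \<Rightarrow> 'g) \<Rightarrow> ('s \<Rightarrow> 'e \<Rightarrow> (real^'n) covector) \<Rightarrow>
     ('g, real^'n) chart \<Rightarrow> 'n \<Rightarrow> 's \<Rightarrow> 'e \<Rightarrow> real" where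
  "A_local \<G> X A c \<alpha> p v = covector_coeffs (dy \<G> c (X p)) (A p v) $ \<alpha>"

definition equations_of_motion ::
    "('s, 'e::euclidean_space) chart set \<Rightarrow> ('g, real^'n) chart set \<Rightarrow> ('g \<Rightarrow> (real^'n) bivector) \<Rightarrow>
     ('s \<Rightarrow> 'g) \<Rightarrow> ('s \<Rightarrow> 'e \<Rightarrow> (real^'n) covector) \<Rightarrow> bool" where
  "equations_of_motion \<S> \<G> P X A \<longleftrightarrow> (\<forall>c\<in>\<G>. \<forall>p\<in>X -` fst c. \<forall>\<alpha>.
     (\<forall>v. dX \<S> \<G> X c \<alpha> p v
          + (\<Sum>\<gamma>\<in>UNIV. bivector_comp \<G> P c \<alpha> \<gamma> (X p) * A_local \<G> X A c \<gamma> p v) = 0) \<and>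
     (\<forall>u v. ext_deriv \<S> (A_local \<G> X A c \<alpha>) p u v
          + 1/2 * (\<Sum>\<beta>\<in>UNIV. \<Sum>\<gamma>\<in>UNIV. partial_deriv c \<alpha> (bivector_comp \<G> P c \<beta> \<gamma>) (X p)
                    * wedge (A_local \<G> X A c \<beta>) (A_local \<G> X A c \<gamma>) p u v) = 0))"

text \<open>The forms \<open>A\<^sub>k\<close> defined by expanding \<open>A\<close> in the right-invariant frame dual to \<open>T\<close>,
  and the form with values in the dual Lie algebra, \<open>A\<^sub>k T\<^sup>k\<close>.\<close>

definition A_right ::
    "('g, real^'n) chart set \<Rightarrow> ('g \<Rightarrow> 'g \<Rightarrow> 'g) \<Rightarrow> ('g \<Rightarrow> 'g) \<Rightarrow> ('n \<Rightarrow> real^'n) \<Rightarrow>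
     ('s \<Rightarrow> 'g) \<Rightarrow> ('s \<Rightarrow> 'e \<Rightarrow> (real^'n) covector) \<Rightarrow> 'n \<Rightarrow> 's \<Rightarrow> 'e \<Rightarrow> real" where
  "A_right \<G> gmult ginv T X A k p v =
     covector_coeffs (\<lambda>j. right_inv_form \<G> gmult ginv (dual_basis T j) (X p)) (A p v) $ k"

definition A_tilde ::
    "('g, real^'n) chart set \<Rightarrow> ('g \<Rightarrow> 'g \<Rightarrow> 'g) \<Rightarrow> ('g \<Rightarrow> 'g) \<Rightarrow> ('n \<Rightarrow> real^'n) \<Rightarrow>
     ('s \<Rightarrow> 'g) \<Rightarrow> ('s \<Rightarrow> 'e \<Rightarrow> (real^'n) covector) \<Rightarrow> 's \<Rightarrow> 'e \<Rightarrow> (real^'n) covector" where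
  "A_tilde \<G> gmult ginv T X A p v =
     (\<Sum>k\<in>UNIV. A_right \<G> gmult ginv T X A k p v *\<^sub>R dual_basis T k)"

definition A_tilde_bracket ::
    "('g, real^'n) chart set \<Rightarrow> ('g \<Rightarrow> 'g \<Rightarrow> 'g) \<Rightarrow> 'g \<Rightarrow> ('g \<Rightarrow> 'g) \<Rightarrow> ('g \<Rightarrow> (real^'n) bivector) \<Rightarrow>
     ('n \<Rightarrow> real^'n) \<Rightarrow> ('s \<Rightarrow> 'g) \<Rightarrow> ('s \<Rightarrow> 'e \<Rightarrow> (real^'n) covector) \<Rightarrow>
     's \<Rightarrow> 'e \<Rightarrow> 'e \<Rightarrow> (real^'n) covector" where
  "A_tilde_bracket \<G> gmult e ginv P T X A p u v =
     (\<Sum>i\<in>UNIV. \<Sum>j\<in>UNIV.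
        wedge (A_right \<G> gmult ginv T X A i) (A_right \<G> gmult ginv T X A j) p u v
        *\<^sub>R dual_bracket \<G> e P (dual_basis T i) (dual_basis T j))"

definition maurer_cartan_pullback ::
    "('s, 'e::euclidean_space) chart set \<Rightarrow> ('g, real^'n) chart set \<Rightarrow> ('g \<Rightarrow> 'g \<Rightarrow> 'g) \<Rightarrow> ('g \<Rightarrow> 'g) \<Rightarrow>
     ('n \<Rightarrow> real^'n) \<Rightarrow> ('s \<Rightarrow> 'g) \<Rightarrow> 's \<Rightarrow> 'e \<Rightarrow> real^'n" where
  "maurer_cartan_pullback \<S> \<G> gmult ginv T X p v =
     maurer_cartan_right \<G> gmult ginv T (X p) (blinfun_apply (tangent_map \<S> \<G> X p) v)"

end

theory Submission
  imports Defs
begin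

text \<open>
  Let \<open>R\<^sub>q\<close> be right translation by \<open>q\<close>. Unfolding the right-invariant frame gives
  \<open>A~(v) = A(v) \<circ> T\<^sub>e R\<^sub>X\<close>, and the first equations are then equivalent pointwise, since both say
  that \<open>\<zeta>(dX(v)) = P(A(v), \<zeta>)\<close> for every covector \<open>\<zeta>\<close> at \<open>X\<close>.

  Write \<open>\<rho>(y) Z\<close> for the coordinate expression of the right-invariant vector field of \<open>Z\<close>.
  Then \<open>A~(v)(Z) = A\<^sub>\<alpha>(v) (\<rho> Z)\<^sup>\<alpha>\<close>, so \<open>dA~\<close> is \<open>(\<rho> Z)\<^sup>\<alpha> dA\<^sub>\<alpha>\<close> plus terms in the
  derivative of \<open>\<rho>\<close> along \<open>dX\<close>, where \<open>dX = -P(A)\<close> may be inserted. Differentiating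
  \<open>P(x y) = L\<^sub>x P(y) + R\<^sub>y P(x)\<close> in \<open>x\<close> at \<open>e\<close>, with symmetry of the second derivatives of the
  multiplication, expresses these terms through \<open>(\<rho> Z)\<^sup>\<alpha> \<partial>\<^sub>\<alpha> P\<close> and \<open>DP(Z)\<close>, that is, the
  bracket of \<open>A~\<close>. Hence the left-hand side of the second invariant equation, evaluated at \<open>Z\<close>,
  is \<open>(\<rho> Z)\<^sup>\<alpha>\<close> times that of the local one, and \<open>\<rho>(y)\<close> is invertible.
\<close>

subsection \<open>Calculus of smooth maps\<close>

text \<open>Stored tangent vectors refer to a preferred chart that jumps with the point, so they
  cannot be differentiated as they stand. The main computation therefore runs in three fixed charts:
  \<open>e_chart\<close> for the left factor of a product, one chart \<open>c\<close> for both the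
  right factor and the product, and the preferred chart of the source point. With this choice Lie
  algebra elements and tangent vectors at the source point are their own components, and
  multiplication by \<open>e\<close> reads as the identity. The right-invariant frame and the left
  translations become the two partial derivatives of a single map, \<open>left_mult c\<close>, so
  equality of its mixed derivatives is the only second-order fact required. \<open>P\<close>
  vanishes at \<open>e\<close>. This removes the terms in which Jacobians of right translations
  would be differentiated, and it makes \<open>DP(Z)\<close> an ordinary derivative in a chart. What
  is proved equivalent is the pair of equations: the two second equations are compared at a point
  only after the first one is known there.\<close>

text \<open>Full derivatives are local, so agreement on an open set passes to the directional
  derivatives; hence the induction over all pairs \<open>f\<close>, \<open>g\<close>.\<close>

lemma Ck_on_cong_imp:
  assumes "open S" "\<And>x. x \<in> S \<Longrightarrow> f x = g x" "Ck_on k f S"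
  shows "Ck_on k g S"
  using assms
proof (induction k arbitrary: f g)
  case 0
  then show ?case by (metis Ck_on.simps(1) continuous_on_cong)
next
  case (Suc k)
  have d: "g differentiable (at x)" if "x \<in> S" for x
  proof -
    have "f differentiable (at x)"
      using Suc.prems(3) that by simp
    then obtain f' where "(f has_derivative f') (at x)"
      unfolding differentiable_def by blast
    then have "(g has_derivative f') (at x)"
      by (rule has_derivative_transform_within_open[OF _ Suc.prems(1) that Suc.prems(2)])
    then show ?thesis by (auto simp: differentiable_def)
  qed
  have e: "frechet_derivative f (at x) = frechet_derivative g (at x)" if "x \<in> S" for x
    using frechet_derivative_transform_within_open[OF _ Suc.prems(1) that Suc.prems(2)] Suc.prems(3) that
    by auto
  have "Ck_on k (\<lambda>x. frechet_derivative g (at x) v) S" for v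
    by (rule Suc.IH[of "\<lambda>x. frechet_derivative f (at x) v"]) (use Suc.prems e in auto)
  then show ?case using d by simp
qed

lemma smooth_on_cong:
  assumes "open S" "\<And>x. x \<in> S \<Longrightarrow> f x = g x" "smooth_on f S"
  shows "smooth_on g S"
  using assms Ck_on_cong_imp unfolding smooth_on_def by blast

lemma smooth_on_subset: "smooth_on f S \<Longrightarrow> R \<subseteq> S \<Longrightarrow> smooth_on f R"
proof -
  have "Ck_on k f S \<Longrightarrow> R \<subseteq> S \<Longrightarrow> Ck_on k f R" for k
    by (induction k arbitrary: f) (auto intro: continuous_on_subset)
  then show "smooth_on f S \<Longrightarrow> R \<subseteq> S \<Longrightarrow> smooth_on f R"
    unfolding smooth_on_def by blast
qed

lemma smooth_on_differentiable: "smooth_on f S \<Longrightarrow> x \<in> S \<Longrightarrow> f differentiable (at x)"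
  unfolding smooth_on_def by (drule spec[of _ "Suc 0"]) simp

lemma smooth_on_has_derivative:
  "smooth_on f S \<Longrightarrow> x \<in> S \<Longrightarrow> (f has_derivative frechet_derivative f (at x)) (at x)"
  using smooth_on_differentiable frechet_derivative_works by blast

lemma smooth_on_directional:
  assumes "smooth_on f S"
  shows "smooth_on (\<lambda>x. frechet_derivative f (at x) v) S"
  unfolding smooth_on_def
proof
  fix k show "Ck_on k (\<lambda>x. frechet_derivative f (at x) v) S"
    using assms[unfolded smooth_on_def, rule_format, of "Suc k"] by simp
qed

lemma smooth_on_imp_continuous_on: "smooth_on f S \<Longrightarrow> continuous_on S f"
  unfolding smooth_on_def by (drule spec[of _ 0]) simp

text \<open>The derivative of the composite along \<open>v\<close> is again a composite with the
  same affine map, now of the derivative of \<open>f\<close> along \<open>L v\<close>. The induction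
  thus closes without any product rule.\<close>

lemma Ck_on_compose_affine:
  assumes "open R" "bounded_linear L" "\<And>y. y \<in> R \<Longrightarrow> L y + b \<in> S" "Ck_on k f S"
  shows "Ck_on k (\<lambda>y. f (L y + b)) R"
  using assms
proof (induction k arbitrary: f)
  case 0
  have "continuous_on R (\<lambda>y. L y + b)"
    by (intro continuous_on_add continuous_on_const linear_continuous_on 0)
  then show ?case
    using 0 continuous_on_compose2[of S f R "\<lambda>y. L y + b"] by auto
next
  case (Suc k)
  interpret L: bounded_linear L by fact
  have D: "((\<lambda>y. f (L y + b)) has_derivative (\<lambda>v. frechet_derivative f (at (L y + b)) (L v))) (at y)"
    if "y \<in> R" for y
  proof -
    have "(f has_derivative frechet_derivative f (at (L y + b))) (at (L y + b))"
      using Suc.prems(3,4) that by (simp add: frechet_derivative_works[symmetric])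
    moreover have "((\<lambda>y. L y + b) has_derivative L) (at y)"
      by (auto intro!: derivative_eq_intros bounded_linear_imp_has_derivative assms)
    ultimately show ?thesis
      using diff_chain_at[of "\<lambda>y. L y + b" L y f] by (simp add: o_def)
  qed
  have "Ck_on k (\<lambda>y. frechet_derivative (\<lambda>y. f (L y + b)) (at y) v) R" for v
  proof (rule Ck_on_cong_imp[OF Suc.prems(1)])
    show "Ck_on k (\<lambda>y. frechet_derivative f (at (L y + b)) (L v)) R"
      using Suc.IH[of "\<lambda>x. frechet_derivative f (at x) (L v)"] Suc.prems by auto
  qed (simp add: frechet_derivative_at[OF D, symmetric])
  then show ?case using D by (auto simp: differentiable_def)
qed

lemma smooth_on_compose_affine:
  assumes "open R" "bounded_linear L" "\<And>y. y \<in> R \<Longrightarrow> L y + b \<in> S" "smooth_on f S"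
  shows "smooth_on (\<lambda>y. f (L y + b)) R"
  using assms(4) unfolding smooth_on_def by (blast intro: Ck_on_compose_affine[OF assms(1-3)])

lemma Ck_on_bounded_linear:
  assumes "open S" "bounded_linear L" "Ck_on k f S"
  shows "Ck_on k (\<lambda>x. L (f x)) S"
  using assms
proof (induction k arbitrary: f)
  case 0
  then show ?case
    by (auto intro: bounded_linear.continuous_on)
next
  case (Suc k)
  have D: "((\<lambda>x. L (f x)) has_derivative (\<lambda>v. L (frechet_derivative f (at x) v))) (at x)"
    if "x \<in> S" for x
    using Suc.prems(3) that
    by (intro bounded_linear.has_derivative[OF Suc.prems(2)]) (simp add: frechet_derivative_works[symmetric])
  have "Ck_on k (\<lambda>y. frechet_derivative (\<lambda>x. L (f x)) (at y) v) S" for v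
  proof (rule Ck_on_cong_imp[OF Suc.prems(1)])
    show "Ck_on k (\<lambda>y. L (frechet_derivative f (at y) v)) S"
      using Suc.IH[of "\<lambda>x. frechet_derivative f (at x) v"] Suc.prems by auto
  qed (simp add: frechet_derivative_at[OF D, symmetric])
  then show ?case using D by (auto simp: differentiable_def)
qed

lemma smooth_on_bounded_linear:
  assumes "open S" "bounded_linear L" "smooth_on f S"
  shows "smooth_on (\<lambda>x. L (f x)) S"
  using assms(3) unfolding smooth_on_def by (blast intro: Ck_on_bounded_linear[OF assms(1,2)])

lemma frechet_derivative_bounded_linear:
  assumes "bounded_linear L" "f differentiable (at x)"
  shows "frechet_derivative (\<lambda>x. L (f x)) (at x) v = L (frechet_derivative f (at x) v)"
proof -
  have "((\<lambda>x. L (f x)) has_derivative (\<lambda>v. L (frechet_derivative f (at x) v))) (at x)"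
    using assms frechet_derivative_works bounded_linear.has_derivative by blast
  then show ?thesis by (simp add: frechet_derivative_at[symmetric])
qed


text \<open>The second difference quotient is symmetric in \<open>u\<close> and \<open>v\<close>; applying the mean value
  theorem to it twice produces an iterated derivative in either order.\<close>

lemma second_difference_mean_value:
  fixes f :: "'a::real_normed_vector \<Rightarrow> real"
  assumes S: "\<And>s r. 0 \<le> s \<Longrightarrow> s \<le> t \<Longrightarrow> 0 \<le> r \<Longrightarrow> r \<le> t \<Longrightarrow> x + s *\<^sub>R u + r *\<^sub>R v \<in> S"
    and f: "\<And>z. z \<in> S \<Longrightarrow> f differentiable (at z)"
    and f': "\<And>z. z \<in> S \<Longrightarrow> (\<lambda>z. frechet_derivative f (at z) u) differentiable (at z)"
    and t: "0 < t"
  obtains s r where "0 \<le> s" "s \<le> t" "0 \<le> r" "r \<le> t"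
    "f (x + t *\<^sub>R u + t *\<^sub>R v) - f (x + t *\<^sub>R u) - f (x + t *\<^sub>R v) + f x
      = t\<^sup>2 * frechet_derivative (\<lambda>z. frechet_derivative f (at z) u) (at (x + s *\<^sub>R u + r *\<^sub>R v)) v"
proof -
  define f1 where "f1 z = frechet_derivative f (at z)" for z
  define f2 where "f2 z = frechet_derivative (\<lambda>z. f1 z u) (at z)" for z
  have D1: "((\<lambda>s. f (x + s *\<^sub>R u + r *\<^sub>R v)) has_derivative (\<lambda>h. f1 (x + s *\<^sub>R u + r *\<^sub>R v) (h *\<^sub>R u))) (at s)"
    if "0 \<le> s" "s \<le> t" "0 \<le> r" "r \<le> t" for s r
  proof -
    have "(f has_derivative f1 (x + s *\<^sub>R u + r *\<^sub>R v)) (at (x + s *\<^sub>R u + r *\<^sub>R v))"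
      using f[OF S[OF that]] unfolding frechet_derivative_works f1_def .
    moreover have "((\<lambda>s. x + s *\<^sub>R u + r *\<^sub>R v) has_derivative (\<lambda>h. h *\<^sub>R u)) (at s)"
      by (auto intro!: derivative_eq_intros)
    ultimately show ?thesis
      using diff_chain_at[of "\<lambda>s. x + s *\<^sub>R u + r *\<^sub>R v" "\<lambda>h. h *\<^sub>R u" s f] by (simp add: o_def)
  qed
  have D2: "((\<lambda>r. f1 (x + s *\<^sub>R u + r *\<^sub>R v) u) has_derivative (\<lambda>h. f2 (x + s *\<^sub>R u + r *\<^sub>R v) (h *\<^sub>R v))) (at r)"
    if "0 \<le> s" "s \<le> t" "0 \<le> r" "r \<le> t" for s r
  proof -
    have "((\<lambda>z. f1 z u) has_derivative f2 (x + s *\<^sub>R u + r *\<^sub>R v)) (at (x + s *\<^sub>R u + r *\<^sub>R v))"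
      using f'[OF S[OF that]] unfolding frechet_derivative_works f1_def f2_def .
    moreover have "((\<lambda>r. x + s *\<^sub>R u + r *\<^sub>R v) has_derivative (\<lambda>h. h *\<^sub>R v)) (at r)"
      by (auto intro!: derivative_eq_intros)
    ultimately show ?thesis
      using diff_chain_at[of "\<lambda>r. x + s *\<^sub>R u + r *\<^sub>R v" "\<lambda>h. h *\<^sub>R v" r "\<lambda>z. f1 z u"] by (simp add: o_def)
  qed
  have lin1: "f1 z (h *\<^sub>R u) = h * f1 z u" if "z \<in> S" for z h
    using linear_frechet_derivative[OF f[OF that]] linear_cmul unfolding f1_def by fastforce
  have lin2: "f2 z (h *\<^sub>R v) = h * f2 z v" if "z \<in> S" for z h
    using linear_frechet_derivative[OF f'[OF that]] linear_cmul unfolding f1_def f2_def by fastforce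
  \<comment> \<open>The zero multiples keep all four corners in the shape of \<open>D1\<close>, with
    \<open>r = t\<close> and \<open>r = 0\<close>.\<close>
  obtain s where s: "0 \<le> s" "s \<le> t"
    and 1: "(f (x + t *\<^sub>R u + t *\<^sub>R v) - f (x + t *\<^sub>R u + 0 *\<^sub>R v)) - (f (x + 0 *\<^sub>R u + t *\<^sub>R v) - f (x + 0 *\<^sub>R u + 0 *\<^sub>R v))
         = f1 (x + s *\<^sub>R u + t *\<^sub>R v) ((t - 0) *\<^sub>R u) - f1 (x + s *\<^sub>R u + 0 *\<^sub>R v) ((t - 0) *\<^sub>R u)"
  proof -
    have "((\<lambda>s. f (x + s *\<^sub>R u + t *\<^sub>R v) - f (x + s *\<^sub>R u + 0 *\<^sub>R v)) has_derivative
        (\<lambda>h. f1 (x + s *\<^sub>R u + t *\<^sub>R v) (h *\<^sub>R u) - f1 (x + s *\<^sub>R u + 0 *\<^sub>R v) (h *\<^sub>R u))) (at s within {0..t})"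
      if "0 \<le> s" "s \<le> t" for s
      by (rule has_derivative_at_withinI, rule has_derivative_diff; rule D1) (use t that in simp_all)
    from mvt_very_simple[where f = "\<lambda>s. f (x + s *\<^sub>R u + t *\<^sub>R v) - f (x + s *\<^sub>R u + 0 *\<^sub>R v)"
        and f' = "\<lambda>s h. f1 (x + s *\<^sub>R u + t *\<^sub>R v) (h *\<^sub>R u) - f1 (x + s *\<^sub>R u + 0 *\<^sub>R v) (h *\<^sub>R u)",
        OF less_imp_le[OF t] this]
    show ?thesis using that by auto
  qed
  obtain r where r: "0 \<le> r" "r \<le> t"
    and 2: "f1 (x + s *\<^sub>R u + t *\<^sub>R v) u - f1 (x + s *\<^sub>R u + 0 *\<^sub>R v) u
         = f2 (x + s *\<^sub>R u + r *\<^sub>R v) ((t - 0) *\<^sub>R v)"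
  proof -
    have "((\<lambda>r. f1 (x + s *\<^sub>R u + r *\<^sub>R v) u) has_derivative
        (\<lambda>h. f2 (x + s *\<^sub>R u + r *\<^sub>R v) (h *\<^sub>R v))) (at r within {0..t})"
      if "0 \<le> r" "r \<le> t" for r
      by (rule has_derivative_at_withinI, rule D2) (use s that in simp_all)
    from mvt_very_simple[where f = "\<lambda>r. f1 (x + s *\<^sub>R u + r *\<^sub>R v) u"
        and f' = "\<lambda>r h. f2 (x + s *\<^sub>R u + r *\<^sub>R v) (h *\<^sub>R v)",
        OF less_imp_le[OF t] this]
    show ?thesis using that by auto
  qed
  have "f (x + t *\<^sub>R u + t *\<^sub>R v) - f (x + t *\<^sub>R u) - f (x + t *\<^sub>R v) + f x
      = t * (f1 (x + s *\<^sub>R u + t *\<^sub>R v) u - f1 (x + s *\<^sub>R u + 0 *\<^sub>R v) u)"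
    using 1 lin1[OF S[OF s, of t]] lin1[OF S[OF s, of 0]] t by (simp add: algebra_simps)
  also have "\<dots> = t * (t * f2 (x + s *\<^sub>R u + r *\<^sub>R v) v)"
    using 2 lin2[OF S[OF s r]] by simp
  finally show ?thesis
    using that[OF s r] by (simp add: f2_def f1_def power2_eq_square)
qed

text \<open>Schwarz's theorem. One second difference equals \<open>t\<^sup>2\<close> times either
  mixed derivative, each at some point near \<open>x\<close>; continuity of both at \<open>x\<close>
  leaves a gap below every \<open>e\<close>.\<close>

lemma frechet_derivative_commute_real:
  fixes f :: "'a::real_normed_vector \<Rightarrow> real"
  assumes "open S" "x \<in> S" "smooth_on f S"
  shows "frechet_derivative (\<lambda>z. frechet_derivative f (at z) u) (at x) v
       = frechet_derivative (\<lambda>z. frechet_derivative f (at z) v) (at x) u"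
proof -
  define f2 where "f2 u v z = frechet_derivative (\<lambda>z. frechet_derivative f (at z) u) (at z) v" for u v z
  have cont: "continuous (at x) (f2 u v)" for u v
    using smooth_on_imp_continuous_on[OF smooth_on_directional[OF smooth_on_directional[OF assms(3)]]] assms(1,2)
    unfolding f2_def by (simp add: continuous_on_eq_continuous_at)
  have le: "dist (f2 u v x) (f2 v u x) \<le> 0 + e" if "e > 0" for e
  proof -
    obtain d1 where d1: "d1 > 0" "\<And>z. dist z x < d1 \<Longrightarrow> dist (f2 u v z) (f2 u v x) < e/2"
      using cont[of u v] \<open>e > 0\<close> unfolding continuous_at_eps_delta dist_norm by (metis half_gt_zero)
    obtain d2 where d2: "d2 > 0" "\<And>z. dist z x < d2 \<Longrightarrow> dist (f2 v u z) (f2 v u x) < e/2"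
      using cont[of v u] \<open>e > 0\<close> unfolding continuous_at_eps_delta dist_norm by (metis half_gt_zero)
    obtain d3 where d3: "d3 > 0" "ball x d3 \<subseteq> S"
      using assms openE by blast
    define d where "d = min d1 (min d2 d3)"
    \<comment> \<open>The summand 1 keeps the denominator positive for \<open>u = v = 0\<close> and
      gives the strict bound that puts the whole parallelogram inside the ball of radius
      \<open>d\<close>.\<close>
    define t where "t = d / (norm u + norm v + 1)"
    have d: "d > 0" using d1 d2 d3 by (simp add: d_def)
    have N: "norm u + norm v + 1 > 0" by (simp add: add_nonneg_pos)
    have t: "t > 0" unfolding t_def using d N by simp
    have near: "dist (x + s *\<^sub>R u + r *\<^sub>R v) x < d" if "0 \<le> s" "s \<le> t" "0 \<le> r" "r \<le> t" for s r
    proof -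
      have "norm (s *\<^sub>R u + r *\<^sub>R v) \<le> s * norm u + r * norm v"
        using norm_triangle_ineq[of "s *\<^sub>R u" "r *\<^sub>R v"] that by simp
      also have "\<dots> \<le> t * norm u + t * norm v"
        using that by (intro add_mono mult_right_mono) auto
      also have "\<dots> < t * (norm u + norm v + 1)" using t by (simp add: algebra_simps)
      also have "\<dots> = d" unfolding t_def using N by simp
      finally show ?thesis by (simp add: dist_norm add.assoc)
    qed
    have inS: "x + s *\<^sub>R u + r *\<^sub>R v \<in> S" if "0 \<le> s" "s \<le> t" "0 \<le> r" "r \<le> t" for s r
      using near[OF that] d3(2) by (auto simp: d_def mem_ball dist_commute)
    have inS': "x + s *\<^sub>R v + r *\<^sub>R u \<in> S" if "0 \<le> s" "s \<le> t" "0 \<le> r" "r \<le> t" for s r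
      using inS[OF that(3,4,1,2)] by (simp add: algebra_simps)
    note sm = smooth_on_differentiable[OF assms(3)]
      smooth_on_differentiable[OF smooth_on_directional[OF assms(3)]]
    obtain s r where 1: "0 \<le> s" "s \<le> t" "0 \<le> r" "r \<le> t"
      "f (x + t *\<^sub>R u + t *\<^sub>R v) - f (x + t *\<^sub>R u) - f (x + t *\<^sub>R v) + f x
        = t\<^sup>2 * f2 u v (x + s *\<^sub>R u + r *\<^sub>R v)"
      using second_difference_mean_value[where f=f and x=x and u=u and v=v and S=S, OF inS sm t] unfolding f2_def by blast
    obtain s' r' where 2: "0 \<le> s'" "s' \<le> t" "0 \<le> r'" "r' \<le> t"
      "f (x + t *\<^sub>R v + t *\<^sub>R u) - f (x + t *\<^sub>R v) - f (x + t *\<^sub>R u) + f x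
        = t\<^sup>2 * f2 v u (x + s' *\<^sub>R v + r' *\<^sub>R u)"
      using second_difference_mean_value[where f=f and x=x and u=v and v=u and S=S, OF inS' sm t] unfolding f2_def by blast
    have "t\<^sup>2 * f2 u v (x + s *\<^sub>R u + r *\<^sub>R v) = t\<^sup>2 * f2 v u (x + r' *\<^sub>R u + s' *\<^sub>R v)"
      using 1(5) 2(5) by (simp add: algebra_simps)
    then have "f2 u v (x + s *\<^sub>R u + r *\<^sub>R v) = f2 v u (x + r' *\<^sub>R u + s' *\<^sub>R v)"
      using t by simp
    moreover have "dist (f2 u v (x + s *\<^sub>R u + r *\<^sub>R v)) (f2 u v x) < e/2"
      using near[OF 1(1-4)] d1 by (simp add: d_def)
    moreover have "dist (f2 v u (x + r' *\<^sub>R u + s' *\<^sub>R v)) (f2 v u x) < e/2"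
      using near[OF 2(3,4,1,2)] d2 by (simp add: d_def)
    ultimately show ?thesis unfolding dist_real_def by linarith
  qed
  have "dist (f2 u v x) (f2 v u x) \<le> 0"
    by (rule field_le_epsilon) (rule le)
  then have "f2 u v x = f2 v u x" by simp
  then show ?thesis by (simp add: f2_def)
qed

text \<open>The mean value argument needs scalar values; inner products with a fixed
  \<open>b\<close> commute with both derivatives and reduce to that case.\<close>

lemma frechet_derivative_commute:
  fixes f :: "'a::real_normed_vector \<Rightarrow> 'b::euclidean_space"
  assumes S: "open S" "x \<in> S" "smooth_on f S"
  shows "frechet_derivative (\<lambda>z. frechet_derivative f (at z) u) (at x) v
       = frechet_derivative (\<lambda>z. frechet_derivative f (at z) v) (at x) u"
proof (rule euclidean_eqI)
  fix b :: 'b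
  have "frechet_derivative (\<lambda>z. frechet_derivative f (at z) u) (at x) v \<bullet> b
      = frechet_derivative (\<lambda>z. frechet_derivative (\<lambda>z. f z \<bullet> b) (at z) u) (at x) v" for u v
  proof -
    have "frechet_derivative (\<lambda>z. frechet_derivative f (at z) u) (at x) v \<bullet> b
        = frechet_derivative (\<lambda>z. frechet_derivative f (at z) u \<bullet> b) (at x) v"
      by (rule frechet_derivative_bounded_linear[symmetric])
        (auto intro!: bounded_linear_inner_left
          smooth_on_differentiable[OF smooth_on_directional[OF S(3)] S(2)])
    also have "\<dots> = frechet_derivative (\<lambda>z. frechet_derivative (\<lambda>z. f z \<bullet> b) (at z) u) (at x) v"
    proof -
      have "frechet_derivative (\<lambda>z. f z \<bullet> b) (at z) u = frechet_derivative f (at z) u \<bullet> b" if "z \<in> S" for z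
        by (rule frechet_derivative_bounded_linear)
          (auto intro!: bounded_linear_inner_left smooth_on_differentiable[OF S(3) that])
      moreover have "(\<lambda>z. frechet_derivative f (at z) u \<bullet> b) differentiable (at x)"
        by (intro differentiable_inner differentiable_const
          smooth_on_differentiable[OF smooth_on_directional[OF S(3)] S(2)])
      ultimately show ?thesis
        using frechet_derivative_transform_within_open[of "\<lambda>z. frechet_derivative f (at z) u \<bullet> b" x S] S
        by metis
    qed
    finally show ?thesis .
  qed
  moreover have "smooth_on (\<lambda>z. f z \<bullet> b) S"
    using smooth_on_bounded_linear[OF S(1) bounded_linear_inner_left S(3)] .
  ultimately show "frechet_derivative (\<lambda>z. frechet_derivative f (at z) u) (at x) v \<bullet> b
      = frechet_derivative (\<lambda>z. frechet_derivative f (at z) v) (at x) u \<bullet> b"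
    using frechet_derivative_commute_real[OF S(1,2)] by metis
qed

subsection \<open>Charts and tangent maps\<close>

text \<open>Being the differential of the chart map, this converts the stored components of a
  tangent vector into its components in \<open>c\<close>.\<close>

abbreviation coords :: "('m, 'e::euclidean_space) chart set \<Rightarrow> ('m, 'e) chart \<Rightarrow> 'm \<Rightarrow> 'e \<Rightarrow> 'e" where
  "coords \<A> c p \<equiv> blinfun_apply (differential \<A> (snd c) p)"

lemma chart_chart_inv: "x \<in> snd c ` fst c \<Longrightarrow> snd c (chart_inv c x) = x"
  by (rule f_inv_into_f)

lemma chart_inv_mem: "x \<in> snd c ` fst c \<Longrightarrow> chart_inv c x \<in> fst c"
  by (rule inv_into_into)

context
  fixes \<A> :: "('m::topological_space, 'e::euclidean_space) chart set"
  assumes atlas: "smooth_atlas \<A>"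
begin

lemma chart_is_chart: "c \<in> \<A> \<Longrightarrow> is_chart c"
  using atlas by (simp add: smooth_atlas_def)

lemma open_chart_domain: "c \<in> \<A> \<Longrightarrow> open (fst c)"
  using chart_is_chart by (simp add: is_chart_def)

lemma open_chart_image: "c \<in> \<A> \<Longrightarrow> open (snd c ` fst c)"
  using chart_is_chart by (simp add: is_chart_def)

lemma chart_homeomorphism:
  "c \<in> \<A> \<Longrightarrow> homeomorphism (fst c) (snd c ` fst c) (snd c) (chart_inv c)"
  using chart_is_chart by (simp add: is_chart_def)

lemma chart_inv_chart: "c \<in> \<A> \<Longrightarrow> p \<in> fst c \<Longrightarrow> chart_inv c (snd c p) = p"
  using chart_homeomorphism homeomorphism_apply1 by blast

lemma chart_image_vimage:
  "c \<in> \<A> \<Longrightarrow> snd c ` (fst c \<inter> U) = (snd c ` fst c) \<inter> chart_inv c -` U"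
  using chart_inv_chart chart_inv_mem chart_chart_inv by fastforce

lemma continuous_on_chart_inv: "c \<in> \<A> \<Longrightarrow> continuous_on (snd c ` fst c) (chart_inv c)"
  using chart_homeomorphism homeomorphism_cont2 by blast

lemma open_chart_image_Int:
  assumes "c \<in> \<A>" "open U"
  shows "open (snd c ` (fst c \<inter> U))"
  unfolding chart_image_vimage[OF assms(1)]
  using continuous_on_chart_inv open_chart_image assms continuous_open_preimage by blast

lemma chart_at_mem: "chart_at \<A> p \<in> \<A>" and mem_chart_at: "p \<in> fst (chart_at \<A> p)"
proof -
  have "p \<in> (\<Union>c\<in>\<A>. fst c)" using atlas by (simp add: smooth_atlas_def)
  then have "\<exists>c. c \<in> \<A> \<and> p \<in> fst c" by blast
  from someI_ex[OF this] show "chart_at \<A> p \<in> \<A>" "p \<in> fst (chart_at \<A> p)"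
    by (simp_all add: chart_at_def)
qed

lemma transition_has_derivative:
  assumes "c \<in> \<A>" "d \<in> \<A>" "p \<in> fst c" "p \<in> fst d"
  shows "(snd d \<circ> chart_inv c has_derivative frechet_derivative (snd d \<circ> chart_inv c) (at (snd c p)))
     (at (snd c p))"
proof (rule smooth_on_has_derivative)
  show "smooth_on (snd d \<circ> chart_inv c) (snd c ` (fst c \<inter> fst d))"
    using atlas assms by (simp add: smooth_atlas_def smooth_transition_def)
qed (use assms in blast)

lemma has_derivative_change_chart:
  assumes "c \<in> \<A>" "d \<in> \<A>" "p \<in> fst c" "p \<in> fst d"
    and f: "(f \<circ> chart_inv d has_derivative F) (at (snd d p))"
  shows "(f \<circ> chart_inv c has_derivative F \<circ> frechet_derivative (snd d \<circ> chart_inv c) (at (snd c p)))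
     (at (snd c p))"
proof (rule has_derivative_transform_within_open)
  have "(f \<circ> chart_inv d has_derivative F) (at ((snd d \<circ> chart_inv c) (snd c p)))"
    using f assms chart_inv_chart by simp
  from diff_chain_at[OF transition_has_derivative[OF assms(1-4)] this]
  show "((f \<circ> chart_inv d) \<circ> (snd d \<circ> chart_inv c) has_derivative
      F \<circ> frechet_derivative (snd d \<circ> chart_inv c) (at (snd c p))) (at (snd c p))" .
  show "open (snd c ` (fst c \<inter> fst d))"
    using assms by (simp add: open_chart_image_Int open_chart_domain)
  show "snd c p \<in> snd c ` (fst c \<inter> fst d)" using assms by blast
  show "((f \<circ> chart_inv d) \<circ> (snd d \<circ> chart_inv c)) x = (f \<circ> chart_inv c) x"
    if "x \<in> snd c ` (fst c \<inter> fst d)" for x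
    using that assms by (auto simp: chart_inv_chart)
qed

lemma blinfun_apply_differential:
  assumes "(f \<circ> chart_inv (chart_at \<A> p) has_derivative F) (at (snd (chart_at \<A> p) p))"
  shows "blinfun_apply (differential \<A> f p) = F"
proof -
  have "frechet_derivative (f \<circ> chart_inv (chart_at \<A> p)) (at (snd (chart_at \<A> p) p)) = F"
    using frechet_derivative_at[OF assms] by simp
  then show ?thesis
    using has_derivative_bounded_linear[OF assms]
    by (simp add: differential_def Let_def bounded_linear_Blinfun_apply)
qed

text \<open>\<open>differential\<close> looks only at the preferred chart. The derivative of the
  transition from there to \<open>c\<close> is \<open>coords \<A> c p\<close>, so the chain rule
  allows any chart.\<close>

lemma differential_apply:
  assumes "c \<in> \<A>" "p \<in> fst c" and f: "(f \<circ> chart_inv c has_derivative F) (at (snd c p))"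
  shows "differential \<A> f p v = F (coords \<A> c p v)"
proof -
  note k = chart_at_mem mem_chart_at
  show ?thesis
    using blinfun_apply_differential[OF has_derivative_change_chart[OF k(1) assms(1) k(2) assms(2) f]]
      blinfun_apply_differential[OF transition_has_derivative[OF k(1) assms(1) k(2) assms(2)]]
    by simp
qed

lemma chart_chart_inv_has_derivative:
  assumes "c \<in> \<A>" "p \<in> fst c"
  shows "(snd c \<circ> chart_inv c has_derivative (\<lambda>v. v)) (at (snd c p))"
proof (rule has_derivative_transform_within_open[OF has_derivative_ident open_chart_image[OF assms(1)]])
  show "x = (snd c \<circ> chart_inv c) x" if "x \<in> snd c ` fst c" for x
    using chart_chart_inv[OF that] by simp
qed (use assms in blast)

lemma coords_chart_at: "coords \<A> (chart_at \<A> p) p v = v"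
  using blinfun_apply_differential[OF chart_chart_inv_has_derivative[OF chart_at_mem mem_chart_at]] by simp

lemma linear_coords: "linear (coords \<A> c p)"
  by (simp add: blinfun.bounded_linear_right bounded_linear.linear)

text \<open>The derivative of the reverse transition is a left inverse, and an injective linear
  endomorphism in finite dimension is onto. This gives the \<open>inv\<close> in
  \<open>tangent_of_coords\<close> its meaning.\<close>

lemma bij_coords:
  assumes "c \<in> \<A>" "p \<in> fst c"
  shows "bij (coords \<A> c p)"
proof -
  define K where "K = frechet_derivative (snd (chart_at \<A> p) \<circ> chart_inv c) (at (snd c p))"
  have "v = K (coords \<A> c p v)" for v
    using differential_apply[OF assms transition_has_derivative[OF assms(1) chart_at_mem assms(2) mem_chart_at]]
    by (simp add: K_def coords_chart_at)
  then have "inj (coords \<A> c p)" by (rule inj_on_inverseI[OF sym])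
  then show ?thesis
    using linear_injective_imp_surjective[OF linear_coords] by (simp add: bij_def)
qed

lemma coords_tangent_of_coords:
  "c \<in> \<A> \<Longrightarrow> p \<in> fst c \<Longrightarrow> coords \<A> c p (tangent_of_coords \<A> c p w) = w"
  using bij_coords by (simp add: tangent_of_coords_def bij_is_surj surj_f_inv_f)

lemma tangent_of_coords_coords:
  "c \<in> \<A> \<Longrightarrow> p \<in> fst c \<Longrightarrow> tangent_of_coords \<A> c p (coords \<A> c p v) = v"
  using bij_coords by (simp add: tangent_of_coords_def bij_is_inj)

lemma tangent_of_coords_chart_at: "tangent_of_coords \<A> (chart_at \<A> p) p v = v"
  using tangent_of_coords_coords[OF chart_at_mem mem_chart_at] coords_chart_at by metis

end

lemma dy_apply:
  fixes \<A> :: "('m::topological_space, real^'n) chart set"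
  assumes "smooth_atlas \<A>" "c \<in> \<A>" "q \<in> fst c"
  shows "dy \<A> c q \<alpha> v = coords \<A> c q v $ \<alpha>"
  unfolding dy_def
proof (rule differential_apply[OF assms])
  have "bounded_linear (\<lambda>x::real^'n. x $ \<alpha>)" by (rule bounded_linear_vec_nth)
  from bounded_linear.has_derivative[OF this chart_chart_inv_has_derivative[OF assms]]
  show "((\<lambda>x. snd c x $ \<alpha>) \<circ> chart_inv c has_derivative (\<lambda>x. x $ \<alpha>)) (at (snd c q))"
    by (simp add: o_def)
qed

context
  fixes \<A> :: "('m::topological_space, 'e::euclidean_space) chart set"
    and \<B> :: "('k::topological_space, 'f::euclidean_space) chart set"
  assumes atlas: "smooth_atlas \<A>" "smooth_atlas \<B>"
begin

text \<open>Frees \<open>tangent_map\<close> from the preferred charts at both ends. Continuity of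
  \<open>f\<close> supplies the open set on which the two chart expressions agree.\<close>

lemma coords_tangent_map:
  assumes cont: "continuous_on UNIV f"
    and cd: "c \<in> \<A>" "p \<in> fst c" "d \<in> \<B>" "f p \<in> fst d"
    and F: "(snd d \<circ> f \<circ> chart_inv c has_derivative F) (at (snd c p))"
  shows "coords \<B> d (f p) (tangent_map \<A> \<B> f p v) = F (coords \<A> c p v)"
proof -
  define h where "h = chart_at \<B> (f p)"
  define H where "H = frechet_derivative (snd h \<circ> chart_inv d) (at (snd d (f p)))"
  have h: "h \<in> \<B>" "f p \<in> fst h"
    unfolding h_def by (rule chart_at_mem[OF atlas(2)], rule mem_chart_at[OF atlas(2)])
  have H: "(snd h \<circ> chart_inv d has_derivative H) (at (snd d (f p)))"
    unfolding H_def by (rule transition_has_derivative[OF atlas(2) cd(3) h(1) cd(4) h(2)])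
  \<comment> \<open>\<open>h\<close> is the preferred chart at \<open>f p\<close>, so the derivative
    of the transition from \<open>d\<close> to \<open>h\<close> undoes
    \<open>coords \<B> d (f p)\<close>.\<close>
  have HJ: "H (coords \<B> d (f p) w) = w" for w
    using differential_apply[OF atlas(2) cd(3,4) H] coords_chart_at[OF atlas(2)] h_def by metis
  have JH: "coords \<B> d (f p) (H w) = w" for w
    by (metis HJ coords_tangent_of_coords[OF atlas(2) cd(3,4)])
  have "((snd h \<circ> f) \<circ> chart_inv c has_derivative H \<circ> F) (at (snd c p))"
  proof (rule has_derivative_transform_within_open)
    have "(snd h \<circ> chart_inv d has_derivative H) (at ((snd d \<circ> f \<circ> chart_inv c) (snd c p)))"
      using H cd chart_inv_chart[OF atlas(1)] by simp
    from diff_chain_at[OF F this]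
    show "((snd h \<circ> chart_inv d) \<circ> (snd d \<circ> f \<circ> chart_inv c) has_derivative H \<circ> F) (at (snd c p))" .
    show "open (snd c ` (fst c \<inter> f -` fst d))"
      using open_chart_image_Int[OF atlas(1) cd(1)] open_chart_domain[OF atlas(2) cd(3)] cont
      by (simp add: continuous_on_open_vimage)
    show "snd c p \<in> snd c ` (fst c \<inter> f -` fst d)" using cd by blast
    show "((snd h \<circ> chart_inv d) \<circ> (snd d \<circ> f \<circ> chart_inv c)) x = ((snd h \<circ> f) \<circ> chart_inv c) x"
      if "x \<in> snd c ` (fst c \<inter> f -` fst d)" for x
      using that cd by (auto simp: chart_inv_chart[OF atlas(1)] chart_inv_chart[OF atlas(2)])
  qed
  from differential_apply[OF atlas(1) cd(1,2) this]
  have "tangent_map \<A> \<B> f p v = H (F (coords \<A> c p v))"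
    by (simp add: tangent_map_def h_def)
  then show ?thesis by (simp add: JH)
qed

lemma smooth_map_has_derivative:
  assumes "smooth_map \<A> \<B> f" "c \<in> \<A>" "p \<in> fst c" "d \<in> \<B>" "f p \<in> fst d"
  shows "(snd d \<circ> f \<circ> chart_inv c has_derivative
      frechet_derivative (snd d \<circ> f \<circ> chart_inv c) (at (snd c p))) (at (snd c p))"
proof (rule smooth_on_has_derivative)
  show "smooth_on (snd d \<circ> f \<circ> chart_inv c) (snd c ` (fst c \<inter> f -` fst d))"
    using assms by (simp add: smooth_map_def)
qed (use assms in blast)

end

lemma tangent_map_id:
  fixes \<A> :: "('m::topological_space, 'e::euclidean_space) chart set"
  assumes "smooth_atlas \<A>" shows "tangent_map \<A> \<A> (\<lambda>x. x) p v = v"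
  using coords_chart_at[OF assms] by (simp add: tangent_map_def o_def)

text \<open>The charts only carry the chain rule: both sides get equal components in
  \<open>k\<close>, where \<open>coords\<close> is injective.\<close>

lemma tangent_map_compose:
  fixes \<A> :: "('m::topological_space, 'e::euclidean_space) chart set"
    and \<B> :: "('k::topological_space, 'f::euclidean_space) chart set"
    and \<C> :: "('l::topological_space, 'g::euclidean_space) chart set"
  assumes atlas: "smooth_atlas \<A>" "smooth_atlas \<B>" "smooth_atlas \<C>"
    and cont: "continuous_on UNIV f" "continuous_on UNIV g"
    and cde: "c \<in> \<A>" "p \<in> fst c" "d \<in> \<B>" "f p \<in> fst d" "k \<in> \<C>" "g (f p) \<in> fst k"
    and F: "(snd d \<circ> f \<circ> chart_inv c has_derivative F) (at (snd c p))"
    and G: "(snd k \<circ> g \<circ> chart_inv d has_derivative G) (at (snd d (f p)))"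
  shows "tangent_map \<A> \<C> (\<lambda>x. g (f x)) p v = tangent_map \<B> \<C> g (f p) (tangent_map \<A> \<B> f p v)"
proof -
  have "(snd k \<circ> (\<lambda>x. g (f x)) \<circ> chart_inv c has_derivative G \<circ> F) (at (snd c p))"
  proof (rule has_derivative_transform_within_open)
    have "(snd k \<circ> g \<circ> chart_inv d has_derivative G) (at ((snd d \<circ> f \<circ> chart_inv c) (snd c p)))"
      using G cde chart_inv_chart[OF atlas(1)] by simp
    from diff_chain_at[OF F this]
    show "((snd k \<circ> g \<circ> chart_inv d) \<circ> (snd d \<circ> f \<circ> chart_inv c) has_derivative G \<circ> F) (at (snd c p))" .
    show "open (snd c ` (fst c \<inter> f -` fst d))"
      using open_chart_image_Int[OF atlas(1) cde(1)] open_chart_domain[OF atlas(2) cde(3)] cont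
      by (simp add: continuous_on_open_vimage)
    show "snd c p \<in> snd c ` (fst c \<inter> f -` fst d)" using cde by blast
    show "((snd k \<circ> g \<circ> chart_inv d) \<circ> (snd d \<circ> f \<circ> chart_inv c)) x = (snd k \<circ> (\<lambda>x. g (f x)) \<circ> chart_inv c) x"
      if "x \<in> snd c ` (fst c \<inter> f -` fst d)" for x
      using that cde by (auto simp: chart_inv_chart[OF atlas(1)] chart_inv_chart[OF atlas(2)])
  qed
  moreover have "continuous_on UNIV (\<lambda>x. g (f x))"
    using continuous_on_compose2[OF cont(2,1)] by simp
  ultimately have "coords \<C> k (g (f p)) (tangent_map \<A> \<C> (\<lambda>x. g (f x)) p v) = G (F (coords \<A> c p v))"
    using coords_tangent_map[OF atlas(1,3), of "\<lambda>x. g (f x)"] cde by (simp add: o_def)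
  also have "\<dots> = coords \<C> k (g (f p)) (tangent_map \<B> \<C> g (f p) (tangent_map \<A> \<B> f p v))"
    using coords_tangent_map[OF atlas(2,3) cont(2) cde(3-6) G]
      coords_tangent_map[OF atlas(1,2) cont(1) cde(1-4) F] by simp
  finally show ?thesis
    using bij_coords[OF atlas(3) cde(5,6)] by (simp add: bij_is_inj inj_eq)
qed

section \<open>Covector bases and their dual frames\<close>

text \<open>Duality makes \<open>E\<close> independent, and its \<open>CARD('n)\<close> vectors then
  span. A covector is fixed by its values on \<open>E\<close>, which resolves the definite
  description in \<open>covector_coeffs\<close>.\<close>

lemma covector_coeffs_dual:
  fixes \<theta> :: "'n \<Rightarrow> (real^'n) covector" and E :: "'n \<Rightarrow> real^'n"
  assumes dual: "\<And>j k. \<theta> j (E k) = (if j = k then 1 else 0)"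
  shows "covector_coeffs \<theta> \<xi> $ k = \<xi> (E k)" and "\<xi> = (\<Sum>k\<in>UNIV. \<xi> (E k) *\<^sub>R \<theta> k)"
proof -
  have sum_E: "(\<Sum>k\<in>UNIV. a k *\<^sub>R \<theta> k) (E j) = a j" for a j
    by (simp add: blinfun.sum_left blinfun.scaleR_left dual if_distrib cong: if_cong)
  have "inj E" by (rule injI) (metis dual zero_neq_one)
  have "independent (range E)"
  proof (rule independent_if_scalars_zero)
    fix f x assume f: "(\<Sum>x\<in>range E. f x *\<^sub>R x) = 0" and "x \<in> range E"
    then obtain j where j: "x = E j" by blast
    have "(\<Sum>k\<in>UNIV. f (E k) *\<^sub>R E k) = 0"
      using f by (simp add: sum.reindex[OF \<open>inj E\<close>] o_def)
    then have "\<theta> j (\<Sum>k\<in>UNIV. f (E k) *\<^sub>R E k) = 0" by (simp add: blinfun.zero_right)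
    then show "f x = 0"
      by (simp add: j blinfun.sum_right blinfun.scaleR_right dual if_distrib cong: if_cong)
  qed simp
  moreover have "card (range E) = CARD('n)"
    using \<open>inj E\<close> by (simp add: card_image)
  ultimately have span: "span (range E) = UNIV"
    using card_eq_dim[of "range E" UNIV] by auto
  have eq: "\<xi> = \<eta>" if "\<And>k. \<xi> (E k) = \<eta> (E k)" for \<xi> \<eta> :: "(real^'n) covector"
  proof (rule blinfun_eqI)
    fix v
    have "linear (blinfun_apply \<xi>)" "linear (blinfun_apply \<eta>)"
      by (simp_all add: blinfun.bounded_linear_right bounded_linear.linear)
    then show "\<xi> v = \<eta> v"
      using linear_eq_on_span[of "blinfun_apply \<xi>" "blinfun_apply \<eta>" "range E" v] that span by auto
  qed
  show exp: "\<xi> = (\<Sum>k\<in>UNIV. \<xi> (E k) *\<^sub>R \<theta> k)"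
    by (rule eq) (simp add: sum_E)
  have "covector_coeffs \<theta> \<xi> = (\<chi> k. \<xi> (E k))"
    unfolding covector_coeffs_def
  proof (rule the_equality)
    show "\<xi> = (\<Sum>k\<in>UNIV. (\<chi> k. \<xi> (E k)) $ k *\<^sub>R \<theta> k)" using exp by simp
    show "a = (\<chi> k. \<xi> (E k))" if "\<xi> = (\<Sum>k\<in>UNIV. a $ k *\<^sub>R \<theta> k)" for a
      using that sum_E by (simp add: vec_eq_iff)
  qed
  then show "covector_coeffs \<theta> \<xi> $ k = \<xi> (E k)" by simp
qed

text \<open>Discharges the definite description in \<open>dual_basis\<close>: independence gives
  existence by linear extension, spanning gives uniqueness.\<close>

lemma dual_basis_apply:
  fixes T :: "'n \<Rightarrow> real^'n"
  assumes "basis_of_lie_algebra T"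
  shows "dual_basis T k (T j) = (if j = k then 1 else 0)"
proof -
  have T: "inj T" "independent (range T)" "span (range T) = UNIV"
    using assms by (auto simp: basis_of_lie_algebra_def)
  obtain g :: "real^'n \<Rightarrow> real" where g: "linear g" "\<And>x. x \<in> range T \<Longrightarrow> g x = (if x = T k then 1 else 0)"
    using linear_independent_extend[OF T(2), of "\<lambda>x. if x = T k then 1 else 0"] by blast
  have "\<exists>!\<xi>::(real^'n) covector. \<forall>j. \<xi> (T j) = (if j = k then 1 else 0)"
  proof (rule ex1I)
    have "bounded_linear g" using g(1) linear_conv_bounded_linear by blast
    then show "\<forall>j. Blinfun g (T j) = (if j = k then 1 else 0)"
      using g(2) T(1) by (auto simp: bounded_linear_Blinfun_apply inj_eq)
    fix \<xi> :: "(real^'n) covector" assume \<xi>: "\<forall>j. \<xi> (T j) = (if j = k then 1 else 0)"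
    show "\<xi> = Blinfun g"
    proof (rule blinfun_eqI)
      fix v
      have "linear (blinfun_apply \<xi>)"
        by (simp add: blinfun.bounded_linear_right bounded_linear.linear)
      moreover have "\<xi> x = g x" if "x \<in> range T" for x
        using that \<xi> g(2) T(1) by (auto simp: inj_eq)
      ultimately have "\<xi> v = g v"
        using linear_eq_on_span[of "blinfun_apply \<xi>" g "range T" v] g(1) T(3) by blast
      then show "\<xi> v = Blinfun g v"
        using \<open>bounded_linear g\<close> by (simp add: bounded_linear_Blinfun_apply)
    qed
  qed
  from theI'[OF this] show ?thesis unfolding dual_basis_def by blast
qed

subsection \<open>Lie groups in charts\<close>

text \<open>A function of the pair, so that derivatives along \<open>(v, 0)\<close> and
  \<open>(0, v)\<close> are the right and left translations of tangent vectors.\<close>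

definition mult_in_charts ::
    "('g \<Rightarrow> 'g \<Rightarrow> 'g) \<Rightarrow> ('g, 'e) chart \<Rightarrow> ('g, 'e) chart \<Rightarrow> ('g, 'e) chart \<Rightarrow> 'e \<times> 'e \<Rightarrow> 'e" where
  "mult_in_charts m a b c = (\<lambda>(x, y). snd c (m (chart_inv a x) (chart_inv b y)))"

definition mult_domain ::
    "('g \<Rightarrow> 'g \<Rightarrow> 'g) \<Rightarrow> ('g, 'e) chart \<Rightarrow> ('g, 'e) chart \<Rightarrow> ('g, 'e) chart \<Rightarrow> ('e \<times> 'e) set" where
  "mult_domain m a b c = {(x, y). x \<in> snd a ` fst a \<and> y \<in> snd b ` fst b \<and>
     m (chart_inv a x) (chart_inv b y) \<in> fst c}"

locale lie_group_in_charts =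
  fixes \<G> :: "('g::topological_space, real^'n) chart set"
    and gmult :: "'g \<Rightarrow> 'g \<Rightarrow> 'g" and e :: 'g and ginv :: "'g \<Rightarrow> 'g"
  assumes lie_group: "lie_group \<G> gmult e ginv"
begin

lemma atlas: "smooth_atlas \<G>"
  using lie_group by (simp add: lie_group_def smooth_structure_def)

lemma is_group: "group gmult e ginv"
  using lie_group by (simp add: lie_group_def)

lemma mult_assoc: "gmult (gmult x y) z = gmult x (gmult y z)"
proof -
  interpret group gmult e ginv by (rule is_group)
  show ?thesis by (rule assoc)
qed

lemma mult_e [simp]: "gmult e x = x" "gmult x e = x"
proof -
  interpret group gmult e ginv by (rule is_group)
  show "gmult e x = x" "gmult x e = x" by simp_all
qed

lemma mult_inv [simp]: "gmult (ginv x) x = e" "gmult x (ginv x) = e"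
proof -
  interpret group gmult e ginv by (rule is_group)
  show "gmult (ginv x) x = e" "gmult x (ginv x) = e" by simp_all
qed

lemma mult_inv_cancel [simp]: "gmult (gmult x y) (ginv y) = x" "gmult (gmult x (ginv y)) y = x"
  by (simp_all add: mult_assoc)

lemma continuous_mult: "continuous_on UNIV (\<lambda>(x, y). gmult x y)"
  using lie_group by (simp add: lie_group_def smooth_map_def)

lemma continuous_right_translation: "continuous_on UNIV (\<lambda>x. gmult x h)"
proof -
  have "continuous_on UNIV (\<lambda>x. (x, h))" by (intro continuous_intros)
  from continuous_on_compose2[OF continuous_mult this] show ?thesis by simp
qed

lemma continuous_left_translation: "continuous_on UNIV (\<lambda>x. gmult h x)"
proof -
  have "continuous_on UNIV (\<lambda>x. (h, x))" by (intro continuous_intros)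
  from continuous_on_compose2[OF continuous_mult this] show ?thesis by simp
qed

lemma open_mult_domain:
  assumes "a \<in> \<G>" "b \<in> \<G>" "c \<in> \<G>"
  shows "open (mult_domain gmult a b c)"
proof -
  have "continuous_on (snd a ` fst a \<times> snd b ` fst b) (\<lambda>z. (chart_inv a (fst z), chart_inv b (snd z)))"
    by (intro continuous_on_Pair
        continuous_on_compose2[OF continuous_on_chart_inv[OF atlas assms(1)] continuous_on_fst[OF continuous_on_id]]
        continuous_on_compose2[OF continuous_on_chart_inv[OF atlas assms(2)] continuous_on_snd[OF continuous_on_id]])
      auto
  from continuous_on_compose2[OF continuous_mult this]
  have "continuous_on (snd a ` fst a \<times> snd b ` fst b) (\<lambda>z. gmult (chart_inv a (fst z)) (chart_inv b (snd z)))"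
    by simp
  moreover have "open (snd a ` fst a \<times> snd b ` fst b)"
    using assms by (intro open_Times open_chart_image[OF atlas])
  ultimately have "open ((snd a ` fst a \<times> snd b ` fst b) \<inter>
      (\<lambda>z. gmult (chart_inv a (fst z)) (chart_inv b (snd z))) -` fst c)"
    using open_chart_domain[OF atlas assms(3)] continuous_open_preimage by blast
  moreover have "(snd a ` fst a \<times> snd b ` fst b) \<inter>
      (\<lambda>z. gmult (chart_inv a (fst z)) (chart_inv b (snd z))) -` fst c = mult_domain gmult a b c"
    by (auto simp: mult_domain_def)
  ultimately show ?thesis by simp
qed

lemma smooth_on_mult_in_charts:
  assumes abc: "a \<in> \<G>" "b \<in> \<G>" "c \<in> \<G>"
  shows "smooth_on (mult_in_charts gmult a b c) (mult_domain gmult a b c)"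
proof (rule smooth_on_cong[OF open_mult_domain[OF abc]])
  define ab where "ab = (fst a \<times> fst b, map_prod (snd a) (snd b))"
  have inj: "inj_on (snd d) (fst d)" if "d \<in> \<G>" for d
    by (rule inj_on_inverseI[of _ "chart_inv d"]) (rule chart_inv_chart[OF atlas that])
  \<comment> \<open>\<open>chart_inv ab\<close> is one \<open>inv_into\<close> on the product;
    injectivity of both charts splits it into components.\<close>
  have inv: "chart_inv ab (x, y) = (chart_inv a x, chart_inv b y)"
    if "x \<in> snd a ` fst a" "y \<in> snd b ` fst b" for x y
  proof (rule inv_into_f_eq)
    show "inj_on (snd ab) (fst ab)"
      using map_prod_inj_on[OF inj inj] abc by (simp add: ab_def)
    show "(chart_inv a x, chart_inv b y) \<in> fst ab"
      using that by (simp add: ab_def chart_inv_mem)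
    show "snd ab (chart_inv a x, chart_inv b y) = (x, y)"
      using that by (simp add: ab_def chart_chart_inv)
  qed
  have "ab \<in> product_atlas \<G> \<G>" using abc unfolding product_atlas_def ab_def by blast
  then have "smooth_on (snd c \<circ> (\<lambda>(x, y). gmult x y) \<circ> chart_inv ab)
      (snd ab ` (fst ab \<inter> (\<lambda>(x, y). gmult x y) -` fst c))"
    using lie_group abc by (simp add: lie_group_def smooth_map_def)
  moreover have "mult_domain gmult a b c \<subseteq> snd ab ` (fst ab \<inter> (\<lambda>(x, y). gmult x y) -` fst c)"
  proof
    fix z assume "z \<in> mult_domain gmult a b c"
    then obtain x y where z: "z = (x, y)" "x \<in> snd a ` fst a" "y \<in> snd b ` fst b"
      "gmult (chart_inv a x) (chart_inv b y) \<in> fst c" by (auto simp: mult_domain_def)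
    have "z = snd ab (chart_inv a x, chart_inv b y)"
      using z by (simp add: ab_def chart_chart_inv)
    moreover have "(chart_inv a x, chart_inv b y) \<in> fst ab \<inter> (\<lambda>(x, y). gmult x y) -` fst c"
      using z by (simp add: ab_def chart_inv_mem)
    ultimately show "z \<in> snd ab ` (fst ab \<inter> (\<lambda>(x, y). gmult x y) -` fst c)" by (rule image_eqI)
  qed
  ultimately show "smooth_on (snd c \<circ> (\<lambda>(x, y). gmult x y) \<circ> chart_inv ab) (mult_domain gmult a b c)"
    by (rule smooth_on_subset)
  show "(snd c \<circ> (\<lambda>(x, y). gmult x y) \<circ> chart_inv ab) z = mult_in_charts gmult a b c z"
    if "z \<in> mult_domain gmult a b c" for z
    using that by (auto simp: mult_domain_def mult_in_charts_def inv)
qed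

lemma mem_mult_domain:
  assumes "a \<in> \<G>" "b \<in> \<G>" "x \<in> fst a" "h \<in> fst b" "gmult x h \<in> fst c"
  shows "(snd a x, snd b h) \<in> mult_domain gmult a b c"
  using assms chart_inv_chart[OF atlas] by (simp add: mult_domain_def)

context
  fixes a b c x h
  assumes charts: "a \<in> \<G>" "b \<in> \<G>" "c \<in> \<G>"
    and mem: "x \<in> fst a" "h \<in> fst b" "gmult x h \<in> fst c"
begin

text \<open>In charts, right translation by \<open>h\<close> is the multiplication restricted to the
  slice with second coordinate \<open>snd b h\<close>.\<close>

lemma right_translation_has_derivative:
  "(snd c \<circ> (\<lambda>x. gmult x h) \<circ> chart_inv a has_derivative
    (\<lambda>v. frechet_derivative (mult_in_charts gmult a b c) (at (snd a x, snd b h)) (v, 0))) (at (snd a x))"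
proof -
  have "(mult_in_charts gmult a b c has_derivative
      frechet_derivative (mult_in_charts gmult a b c) (at (snd a x, snd b h))) (at (snd a x, snd b h))"
    using smooth_on_has_derivative[OF smooth_on_mult_in_charts[OF charts]] mem_mult_domain charts mem by blast
  moreover have "((\<lambda>y. (y, snd b h)) has_derivative (\<lambda>v. (v, 0))) (at (snd a x))"
    by (auto intro!: derivative_eq_intros)
  ultimately have "(mult_in_charts gmult a b c \<circ> (\<lambda>y. (y, snd b h)) has_derivative
      frechet_derivative (mult_in_charts gmult a b c) (at (snd a x, snd b h)) \<circ> (\<lambda>v. (v, 0))) (at (snd a x))"
    by (intro diff_chain_at)
  moreover have "mult_in_charts gmult a b c \<circ> (\<lambda>y. (y, snd b h)) = snd c \<circ> (\<lambda>x. gmult x h) \<circ> chart_inv a"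
    using chart_inv_chart[OF atlas charts(2) mem(2)] by (auto simp: mult_in_charts_def)
  ultimately show ?thesis by (simp add: o_def)
qed

lemma left_translation_has_derivative:
  "(snd c \<circ> (\<lambda>h. gmult x h) \<circ> chart_inv b has_derivative
    (\<lambda>v. frechet_derivative (mult_in_charts gmult a b c) (at (snd a x, snd b h)) (0, v))) (at (snd b h))"
proof -
  have "(mult_in_charts gmult a b c has_derivative
      frechet_derivative (mult_in_charts gmult a b c) (at (snd a x, snd b h))) (at (snd a x, snd b h))"
    using smooth_on_has_derivative[OF smooth_on_mult_in_charts[OF charts]] mem_mult_domain charts mem by blast
  moreover have "((\<lambda>y. (snd a x, y)) has_derivative (\<lambda>v. (0, v))) (at (snd b h))"
    by (auto intro!: derivative_eq_intros)
  ultimately have "(mult_in_charts gmult a b c \<circ> (\<lambda>y. (snd a x, y)) has_derivative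
      frechet_derivative (mult_in_charts gmult a b c) (at (snd a x, snd b h)) \<circ> (\<lambda>v. (0, v))) (at (snd b h))"
    by (intro diff_chain_at)
  moreover have "mult_in_charts gmult a b c \<circ> (\<lambda>y. (snd a x, y)) = snd c \<circ> (\<lambda>h. gmult x h) \<circ> chart_inv b"
    using chart_inv_chart[OF atlas charts(1) mem(1)] by (auto simp: mult_in_charts_def)
  ultimately show ?thesis by (simp add: o_def)
qed

lemma coords_right_translation:
  "coords \<G> c (gmult x h) (tangent_map \<G> \<G> (\<lambda>x. gmult x h) x v) =
   frechet_derivative (mult_in_charts gmult a b c) (at (snd a x, snd b h)) (coords \<G> a x v, 0)"
  using coords_tangent_map[OF atlas atlas continuous_right_translation charts(1) mem(1) charts(3) mem(3)
      right_translation_has_derivative] .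

lemma coords_left_translation:
  "coords \<G> c (gmult x h) (tangent_map \<G> \<G> (\<lambda>h. gmult x h) h v) =
   frechet_derivative (mult_in_charts gmult a b c) (at (snd a x, snd b h)) (0, coords \<G> b h v)"
  using coords_tangent_map[OF atlas atlas continuous_left_translation charts(2) mem(2) charts(3) mem(3)
      left_translation_has_derivative] .

end

section \<open>Right translations and the right-invariant frame\<close>

text \<open>\<open>right_to q Z\<close> is the value at \<open>q\<close> of the right-invariant
  vector field of \<open>Z\<close>. Its inverse \<open>right_from q\<close> is the map through which
  right-invariant forms factor.\<close>

definition right_to :: "'g \<Rightarrow> (real^'n) \<Rightarrow>\<^sub>L (real^'n)" where
  "right_to q = tangent_map \<G> \<G> (\<lambda>x. gmult x q) e"

definition right_from :: "'g \<Rightarrow> (real^'n) \<Rightarrow>\<^sub>L (real^'n)" where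
  "right_from q = tangent_map \<G> \<G> (\<lambda>x. gmult x (ginv q)) q"

text \<open>Translating by \<open>h\<close> and then by \<open>k\<close> is the identity map, so the
  chain rule applies. The pairs \<open>q\<close>, \<open>ginv q\<close> and \<open>ginv q\<close>,
  \<open>q\<close> give the two cancellation laws below.\<close>

lemma tangent_map_right_translations:
  assumes "gmult h k = e"
  shows "tangent_map \<G> \<G> (\<lambda>x. gmult x k) (gmult x h) (tangent_map \<G> \<G> (\<lambda>x. gmult x h) x v) = v"
proof -
  note ch = chart_at_mem[OF atlas] mem_chart_at[OF atlas]
  have [simp]: "gmult (gmult y h) k = y" for y using assms by (simp add: mult_assoc)
  have "tangent_map \<G> \<G> (\<lambda>x. gmult (gmult x h) k) x v
      = tangent_map \<G> \<G> (\<lambda>x. gmult x k) (gmult x h) (tangent_map \<G> \<G> (\<lambda>x. gmult x h) x v)"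
    by (rule tangent_map_compose[where f = "\<lambda>x. gmult x h" and g = "\<lambda>x. gmult x k",
          OF atlas atlas atlas continuous_right_translation continuous_right_translation
          ch(1) ch(2) ch(1) ch(2) ch(1) ch(2)
          right_translation_has_derivative[OF ch(1) ch(1) ch(1) ch(2) ch(2) ch(2)]
          right_translation_has_derivative[OF ch(1) ch(1) ch(1) ch(2) ch(2) ch(2)]])
  then show ?thesis using tangent_map_id[OF atlas] by simp
qed

lemma right_from_to [simp]: "right_from q (right_to q v) = v"
  using tangent_map_right_translations[of q "ginv q" e v] by (simp add: right_from_def right_to_def)

lemma right_to_from [simp]: "right_to q (right_from q v) = v"
  using tangent_map_right_translations[of "ginv q" q q v] by (simp add: right_from_def right_to_def)

lemma right_to_e [simp]: "right_to e v = v"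
  using tangent_map_id[OF atlas] by (simp add: right_to_def)

definition e_chart :: "('g, real^'n) chart" where
  "e_chart = chart_at \<G> e"

lemma e_chart: "e_chart \<in> \<G>" "e \<in> fst e_chart" "coords \<G> e_chart e v = v"
  using chart_at_mem[OF atlas] mem_chart_at[OF atlas] coords_chart_at[OF atlas] by (simp_all add: e_chart_def)

text \<open>The same chart \<open>c\<close> serves the right factor and the product, so for left
  factor \<open>e\<close> the map is the identity in the second coordinate.\<close>

abbreviation left_mult :: "('g, real^'n) chart \<Rightarrow> (real^'n) \<times> (real^'n) \<Rightarrow> real^'n" where
  "left_mult c \<equiv> mult_in_charts gmult e_chart c c"

text \<open>The \<rho>(y) Z of the overview. Written as a partial derivative of the multiplication
  it is visibly smooth in \<open>y\<close>, and its own derivative is a mixed second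
  derivative.\<close>

definition right_frame :: "('g, real^'n) chart \<Rightarrow> real^'n \<Rightarrow> real^'n \<Rightarrow> real^'n" where
  "right_frame c Z y = frechet_derivative (left_mult c) (at (snd e_chart e, y)) (Z, 0)"

lemma coords_right_to:
  assumes "c \<in> \<G>" "q \<in> fst c"
  shows "coords \<G> c q (right_to q Z) = right_frame c Z (snd c q)"
  using coords_right_translation[OF e_chart(1) assms(1) assms(1) e_chart(2) assms(2), of Z] assms e_chart
  by (simp add: right_to_def right_frame_def)

lemma e_mem_mult_domain:
  assumes "c \<in> \<G>" "y \<in> snd c ` fst c"
  shows "(snd e_chart e, y) \<in> mult_domain gmult e_chart c c"
  using assms e_chart chart_inv_chart[OF atlas] by (simp add: mult_domain_def chart_inv_mem)

text \<open>The slice over \<open>e\<close> is the image of the affine map \<open>y\<close> to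
  \<open>(0, y) + (snd e_chart e, 0)\<close>.\<close>

lemma smooth_on_at_e:
  assumes "c \<in> \<G>" "smooth_on f (mult_domain gmult e_chart c c)"
  shows "smooth_on (\<lambda>y. f (snd e_chart e, y)) (snd c ` fst c)"
proof -
  have "bounded_linear (\<lambda>y::real^'n. (0::real^'n, y))"
    by (intro bounded_linear_Pair bounded_linear_zero bounded_linear_ident)
  from smooth_on_compose_affine[OF open_chart_image[OF atlas assms(1)] this _ assms(2), of "(snd e_chart e, 0)"]
  show ?thesis using e_mem_mult_domain[OF assms(1)] by simp
qed

lemma frechet_derivative_at_e:
  assumes "c \<in> \<G>" "y \<in> snd c ` fst c" "smooth_on f (mult_domain gmult e_chart c c)"
  shows "frechet_derivative (\<lambda>y. f (snd e_chart e, y)) (at y) w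
    = frechet_derivative f (at (snd e_chart e, y)) (0, w)"
proof -
  have "((\<lambda>y. (snd e_chart e, y)) has_derivative (\<lambda>v. (0, v))) (at y)"
    by (auto intro!: derivative_eq_intros)
  from diff_chain_at[OF this smooth_on_has_derivative[OF assms(3) e_mem_mult_domain[OF assms(1,2)]]]
  have "((\<lambda>y. f (snd e_chart e, y)) has_derivative
      (\<lambda>v. frechet_derivative f (at (snd e_chart e, y)) (0, v))) (at y)"
    by (simp add: o_def)
  from frechet_derivative_at[OF this, symmetric] show ?thesis by simp
qed

lemma smooth_on_right_frame: "c \<in> \<G> \<Longrightarrow> smooth_on (right_frame c Z) (snd c ` fst c)"
  unfolding right_frame_def
  using smooth_on_at_e[OF _ smooth_on_directional[OF smooth_on_mult_in_charts[OF e_chart(1)]]] by blast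

lemma left_mult_e: "y \<in> snd c ` fst c \<Longrightarrow> left_mult c (snd e_chart e, y) = y"
  using e_chart chart_inv_chart[OF atlas] by (simp add: mult_in_charts_def chart_chart_inv)

text \<open>Left multiplication by \<open>e\<close> is the identity. In the differentiated
  multiplicativity the Jacobians of left translation that are not differentiated thereby become
  Kronecker deltas.\<close>

lemma frechet_derivative_left_mult_snd:
  assumes "c \<in> \<G>" "y \<in> snd c ` fst c"
  shows "frechet_derivative (left_mult c) (at (snd e_chart e, y)) (0, w) = w"
proof -
  have "frechet_derivative (left_mult c) (at (snd e_chart e, y)) (0, w)
      = frechet_derivative (\<lambda>y. left_mult c (snd e_chart e, y)) (at y) w"
    by (rule frechet_derivative_at_e[OF assms smooth_on_mult_in_charts[OF e_chart(1) assms(1) assms(1)], symmetric])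
  also have "\<dots> = w"
  proof -
    have "((\<lambda>y. left_mult c (snd e_chart e, y)) has_derivative (\<lambda>v. v)) (at y)"
      by (rule has_derivative_transform_within_open[OF has_derivative_ident open_chart_image[OF atlas assms(1)] assms(2)])
        (simp add: left_mult_e)
    from frechet_derivative_at[OF this, symmetric] show ?thesis by simp
  qed
  finally show ?thesis .
qed



text \<open>The change of left translation as its base point leaves \<open>e\<close> along
  \<open>Z\<close>, and the change of the right-invariant field of \<open>Z\<close> along
  \<open>w\<close>, are the same mixed derivative of the multiplication in the two orders.\<close>

lemma frechet_derivative_right_frame:
  assumes "c \<in> \<G>" "y \<in> snd c ` fst c"
  shows "frechet_derivative (\<lambda>z. frechet_derivative (left_mult c) (at z) (0, w)) (at (snd e_chart e, y)) (Z, 0)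
    = frechet_derivative (right_frame c Z) (at y) w"
proof -
  note sm = smooth_on_mult_in_charts[OF e_chart(1) assms(1) assms(1)]
  show ?thesis
    unfolding right_frame_def
      frechet_derivative_at_e[OF assms smooth_on_directional[OF sm]]
    by (rule frechet_derivative_commute[OF open_mult_domain[OF e_chart(1) assms(1) assms(1)]
          e_mem_mult_domain[OF assms] sm])
qed

text \<open>Extends every \<open>Z\<close> to a global smooth field; without an extension the
  condition inside \<open>intrinsic_derivative\<close> would hold vacuously.\<close>

lemma smooth_vector_field_right_to: "smooth_vector_field \<G> (\<lambda>q. right_to q Z)"
  unfolding smooth_vector_field_def
proof (intro ballI allI)
  fix c \<alpha> assume c: "c \<in> \<G>"
  show "smooth_on ((\<lambda>q. dy \<G> c q \<alpha> (right_to q Z)) \<circ> chart_inv c) (snd c ` fst c)"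
  proof (rule smooth_on_cong[OF open_chart_image[OF atlas c]])
    show "smooth_on (\<lambda>y. right_frame c Z y $ \<alpha>) (snd c ` fst c)"
      by (rule smooth_on_bounded_linear[OF open_chart_image[OF atlas c] bounded_linear_vec_nth smooth_on_right_frame[OF c]])
    show "right_frame c Z y $ \<alpha> = ((\<lambda>q. dy \<G> c q \<alpha> (right_to q Z)) \<circ> chart_inv c) y"
      if "y \<in> snd c ` fst c" for y
      using dy_apply[OF atlas c chart_inv_mem[OF that]] coords_right_to[OF c chart_inv_mem[OF that]]
        chart_chart_inv[OF that] by simp
  qed
qed

end

subsection \<open>Multiplicative bivector fields\<close>

lemma linear_axis_expansion:
  fixes f :: "real^'n \<Rightarrow> 'b::real_vector"
  assumes "linear f"
  shows "f x = (\<Sum>i\<in>UNIV. x $ i *\<^sub>R f (axis i 1))"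
proof -
  have "x = (\<Sum>i\<in>UNIV. x $ i *\<^sub>R axis i 1)"
    using basis_expansion[of x] by (simp add: scalar_mult_eq_scaleR)
  then have "f x = f (\<Sum>i\<in>UNIV. x $ i *\<^sub>R axis i 1)" by simp
  also have "\<dots> = (\<Sum>i\<in>UNIV. x $ i *\<^sub>R f (axis i 1))"
    using assms by (simp add: linear_sum linear_cmul)
  finally show ?thesis .
qed

lemma linear_component_expansion:
  fixes f :: "real^'n \<Rightarrow> real^'m"
  assumes "linear f"
  shows "f x $ j = (\<Sum>i\<in>UNIV. f (axis i 1) $ j * x $ i)"
  by (subst linear_axis_expansion[OF assms]) (simp add: mult.commute)

context
  fixes \<A> :: "('m::topological_space, real^'n) chart set" and c q
  assumes atlas: "smooth_atlas \<A>" and c: "c \<in> \<A>" "q \<in> fst c"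
begin

lemma dy_dual: "dy \<A> c q j (tangent_of_coords \<A> c q (axis k 1)) = (if j = k then 1 else 0)"
  by (simp add: dy_apply[OF atlas c] coords_tangent_of_coords[OF atlas c] axis_def)

lemma covector_coeffs_dy: "covector_coeffs (dy \<A> c q) \<xi> $ k = \<xi> (tangent_of_coords \<A> c q (axis k 1))"
  by (rule covector_coeffs_dual) (rule dy_dual)

lemma covector_expansion_dy:
  fixes \<xi> :: "(real^'n) covector"
  shows "\<xi> = (\<Sum>k\<in>UNIV. \<xi> (tangent_of_coords \<A> c q (axis k 1)) *\<^sub>R dy \<A> c q k)"
  by (rule covector_coeffs_dual) (rule dy_dual)

end

locale poisson_lie_group_in_charts = lie_group_in_charts \<G> gmult e ginv
  for \<G> :: "('g::topological_space, real^'n) chart set"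
    and gmult :: "'g \<Rightarrow> 'g \<Rightarrow> 'g" and e :: 'g and ginv :: "'g \<Rightarrow> 'g" +
  fixes P :: "'g \<Rightarrow> (real^'n) bivector"
  assumes poisson_lie: "poisson_lie_group \<G> gmult e ginv P"
begin

lemma bilinear_P: "bilinear (P q)" and P_antisym: "P q \<xi> \<eta> = - P q \<eta> \<xi>"
  using poisson_lie unfolding poisson_lie_group_def poisson_bivector_def smooth_bivector_field_def
  by blast+

lemma smooth_on_bivector_comp:
  "c \<in> \<G> \<Longrightarrow> smooth_on (bivector_comp \<G> P c \<beta> \<gamma> \<circ> chart_inv c) (snd c ` fst c)"
  using poisson_lie unfolding poisson_lie_group_def poisson_bivector_def smooth_bivector_field_def
  by blast

lemma P_mult:
  "P (gmult g h) \<xi> \<eta> =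
     P h (\<xi> o\<^sub>L tangent_map \<G> \<G> (\<lambda>x. gmult g x) h) (\<eta> o\<^sub>L tangent_map \<G> \<G> (\<lambda>x. gmult g x) h) +
     P g (\<xi> o\<^sub>L tangent_map \<G> \<G> (\<lambda>x. gmult x h) g) (\<eta> o\<^sub>L tangent_map \<G> \<G> (\<lambda>x. gmult x h) g)"
  using poisson_lie unfolding poisson_lie_group_def push_bivector_def by blast

text \<open>Both translations by \<open>e\<close> are the identity, so multiplicativity at
  \<open>e\<close>, \<open>e\<close> says that \<open>P e\<close> equals twice itself.\<close>

lemma P_e: "P e \<xi> \<eta> = 0"
proof -
  have "\<zeta> o\<^sub>L tangent_map \<G> \<G> (\<lambda>x. x) e = \<zeta>" for \<zeta> :: "(real^'n) covector"
    by (rule blinfun_eqI) (simp add: tangent_map_id[OF atlas])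
  then show ?thesis using P_mult[of e e \<xi> \<eta>] by simp
qed

lemma P_sum:
  "P q (\<Sum>i\<in>UNIV. f i *\<^sub>R \<theta> i) (\<Sum>j\<in>UNIV. g j *\<^sub>R \<kappa> j)
    = (\<Sum>i\<in>(UNIV::'n set). \<Sum>j\<in>(UNIV::'n set). f i * g j * P q (\<theta> i) (\<kappa> j))"
proof -
  have l: "linear (\<lambda>x. P q x y)" "linear (P q x)" for x y
    using bilinear_P by (auto simp: bilinear_def)
  have "P q (\<Sum>i\<in>UNIV. f i *\<^sub>R \<theta> i) (\<Sum>j\<in>UNIV. g j *\<^sub>R \<kappa> j)
      = (\<Sum>i\<in>UNIV. f i * P q (\<theta> i) (\<Sum>j\<in>UNIV. g j *\<^sub>R \<kappa> j))"
    by (subst linear_sum[OF l(1)]) (simp add: linear_cmul[OF l(1)])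
  also have "\<dots> = (\<Sum>i\<in>UNIV. f i * (\<Sum>j\<in>UNIV. g j * P q (\<theta> i) (\<kappa> j)))"
    by (subst linear_sum[OF l(2)]) (simp add: linear_cmul[OF l(2)])
  finally show ?thesis by (simp add: sum_distrib_left mult.assoc)
qed

section \<open>Multiplicativity in coordinates and its derivative at the identity\<close>

definition P_loc :: "('g, real^'n) chart \<Rightarrow> 'n \<Rightarrow> 'n \<Rightarrow> real^'n \<Rightarrow> real" where
  "P_loc c \<beta> \<gamma> = bivector_comp \<G> P c \<beta> \<gamma> \<circ> chart_inv c"

lemma smooth_on_P_loc: "c \<in> \<G> \<Longrightarrow> smooth_on (P_loc c \<beta> \<gamma>) (snd c ` fst c)"
  unfolding P_loc_def by (rule smooth_on_bivector_comp)

lemma P_loc_chart: "c \<in> \<G> \<Longrightarrow> q \<in> fst c \<Longrightarrow> P_loc c \<beta> \<gamma> (snd c q) = P q (dy \<G> c q \<beta>) (dy \<G> c q \<gamma>)"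
  using chart_inv_chart[OF atlas] by (simp add: P_loc_def bivector_comp_def)

lemma P_loc_e: "P_loc e_chart \<beta> \<gamma> (snd e_chart e) = 0"
  using P_loc_chart[OF e_chart(1,2)] P_e by simp

text \<open>Pushing a bivector forward means pulling \<open>dy\<close> back, and the coefficients of
  the pulled-back \<open>dy\<close> are rows of the partial Jacobians of the multiplication: left
  translation moves the right factor, right translation the left one.\<close>

lemma P_loc_left_mult:
  assumes c: "c \<in> \<G>" and z: "(x, y) \<in> mult_domain gmult e_chart c c"
  defines "D \<equiv> frechet_derivative (left_mult c) (at (x, y))"
  shows "P_loc c \<beta> \<gamma> (left_mult c (x, y)) =
    (\<Sum>\<delta>\<in>UNIV. \<Sum>\<epsilon>\<in>UNIV. D (0, axis \<delta> 1) $ \<beta> * D (0, axis \<epsilon> 1) $ \<gamma> * P_loc c \<delta> \<epsilon> y) +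
    (\<Sum>\<delta>\<in>UNIV. \<Sum>\<epsilon>\<in>UNIV. D (axis \<delta> 1, 0) $ \<beta> * D (axis \<epsilon> 1, 0) $ \<gamma> * P_loc e_chart \<delta> \<epsilon> x)"
proof -
  define g where "g = chart_inv e_chart x"
  define h where "h = chart_inv c y"
  have gh: "g \<in> fst e_chart" "h \<in> fst c" "gmult g h \<in> fst c" "snd e_chart g = x" "snd c h = y"
    using z by (auto simp: mult_domain_def g_def h_def chart_inv_mem chart_chart_inv)
  note tl = coords_left_translation[OF e_chart(1) c c gh(1-3), unfolded gh(4,5), folded D_def]
  note tr = coords_right_translation[OF e_chart(1) c c gh(1-3), unfolded gh(4,5), folded D_def]
  have "linear D"
    unfolding D_def
    by (rule linear_frechet_derivative)
      (rule smooth_on_differentiable[OF smooth_on_mult_in_charts[OF e_chart(1) c c] z])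
  have lin: "linear (\<lambda>w. D (0, w))" "linear (\<lambda>w. D (w, 0))"
  proof -
    have "linear (\<lambda>w::real^'n. (0::real^'n, w))" "linear (\<lambda>w::real^'n. (w, 0::real^'n))"
      by (rule linearI; simp)+
    from this[THEN linear_compose, OF \<open>linear D\<close>]
    show "linear (\<lambda>w. D (0, w))" "linear (\<lambda>w. D (w, 0))" unfolding o_def .
  qed
  have L: "dy \<G> c (gmult g h) \<beta> o\<^sub>L tangent_map \<G> \<G> (\<lambda>x. gmult g x) h
      = (\<Sum>\<delta>\<in>UNIV. D (0, axis \<delta> 1) $ \<beta> *\<^sub>R dy \<G> c h \<delta>)" for \<beta>
    by (rule blinfun_eqI)
      (simp add: dy_apply[OF atlas c gh(3)] dy_apply[OF atlas c gh(2)] tl blinfun.sum_left blinfun.scaleR_left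
        linear_component_expansion[OF lin(1), of "coords \<G> c h v" for v])
  have R: "dy \<G> c (gmult g h) \<beta> o\<^sub>L tangent_map \<G> \<G> (\<lambda>x. gmult x h) g
      = (\<Sum>\<delta>\<in>UNIV. D (axis \<delta> 1, 0) $ \<beta> *\<^sub>R dy \<G> e_chart g \<delta>)" for \<beta>
    by (rule blinfun_eqI)
      (simp add: dy_apply[OF atlas c gh(3)] dy_apply[OF atlas e_chart(1) gh(1)] tr blinfun.sum_left
        blinfun.scaleR_left linear_component_expansion[OF lin(2), of "coords \<G> e_chart g v" for v])
  have "left_mult c (x, y) = snd c (gmult g h)"
    by (simp add: mult_in_charts_def g_def h_def)
  then have "P_loc c \<beta> \<gamma> (left_mult c (x, y)) = P (gmult g h) (dy \<G> c (gmult g h) \<beta>) (dy \<G> c (gmult g h) \<gamma>)"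
    using P_loc_chart[OF c gh(3)] by simp
  also have "\<dots> = (\<Sum>\<delta>\<in>UNIV. \<Sum>\<epsilon>\<in>UNIV. D (0, axis \<delta> 1) $ \<beta> * D (0, axis \<epsilon> 1) $ \<gamma> * P_loc c \<delta> \<epsilon> y) +
    (\<Sum>\<delta>\<in>UNIV. \<Sum>\<epsilon>\<in>UNIV. D (axis \<delta> 1, 0) $ \<beta> * D (axis \<epsilon> 1, 0) $ \<gamma> * P_loc e_chart \<delta> \<epsilon> x)"
    unfolding P_mult L R P_sum P_loc_chart[OF c gh(2), unfolded gh] P_loc_chart[OF e_chart(1) gh(1), unfolded gh] ..
  finally show ?thesis .
qed

text \<open>The components of \<open>DP\<close>: as \<open>P\<close> vanishes at \<open>e\<close>,
  the ordinary derivative in a chart is already intrinsic.\<close>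

definition dP_e :: "'n \<Rightarrow> 'n \<Rightarrow> real^'n \<Rightarrow> real" where
  "dP_e \<beta> \<gamma> = frechet_derivative (P_loc e_chart \<beta> \<gamma>) (at (snd e_chart e))"

lemma e_mem_image: "snd e_chart e \<in> snd e_chart ` fst e_chart"
  using e_chart by blast

lemma linear_dP_e: "linear (dP_e \<beta> \<gamma>)"
  unfolding dP_e_def
  by (rule linear_frechet_derivative)
    (rule smooth_on_differentiable[OF smooth_on_P_loc[OF e_chart(1)] e_mem_image])

text \<open>The left factor is moved off \<open>e\<close> along \<open>Z\<close>. In the first sum
  \<open>y\<close> is fixed and only the Jacobians of left translation vary, which yields
  \<open>R\<close>. In the second sum only the factor \<open>P_loc e_chart\<close> contributes,
  since it is zero at \<open>e\<close>.\<close>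

lemma frechet_derivative_P_loc_right_frame:
  fixes Z
  assumes c: "c \<in> \<G>" and y: "y \<in> snd c ` fst c"
  defines "R \<equiv> frechet_derivative (right_frame c Z) (at y)"
  shows "frechet_derivative (P_loc c \<beta> \<gamma>) (at y) (right_frame c Z y) =
    (\<Sum>\<delta>\<in>UNIV. \<Sum>\<epsilon>\<in>UNIV. (axis \<delta> 1 $ \<beta> * R (axis \<epsilon> 1) $ \<gamma> + R (axis \<delta> 1) $ \<beta> * axis \<epsilon> 1 $ \<gamma>) * P_loc c \<delta> \<epsilon> y) +
    (\<Sum>\<delta>\<in>UNIV. \<Sum>\<epsilon>\<in>UNIV. right_frame c (axis \<delta> 1) y $ \<beta> * right_frame c (axis \<epsilon> 1) y $ \<gamma> * dP_e \<delta> \<epsilon> Z)"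
proof -
  define N where "N = left_mult c"
  define z0 where "z0 = (snd e_chart e, y)"
  define \<Omega> where "\<Omega> = mult_domain gmult e_chart c c"
  define D where "D z = frechet_derivative N (at z)" for z
  define D2 where "D2 w = frechet_derivative (\<lambda>z. D z w) (at z0)" for w
  define U where "U = (\<lambda>x. (x, y)) -` \<Omega>"
  have sm: "smooth_on N \<Omega>"
    unfolding N_def \<Omega>_def by (rule smooth_on_mult_in_charts[OF e_chart(1) c c])
  have z0: "z0 \<in> \<Omega>" unfolding z0_def \<Omega>_def by (rule e_mem_mult_domain[OF c y])
  have "open U"
    unfolding U_def \<Omega>_def
    by (rule open_vimage[OF open_mult_domain[OF e_chart(1) c c]]) (intro continuous_intros)
  have pair: "((\<lambda>x. (x, y)) has_derivative (\<lambda>v. (v, 0))) (at (snd e_chart e))"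
    by (auto intro!: derivative_eq_intros)
  have dN: "((\<lambda>x. N (x, y)) has_derivative (\<lambda>v. D z0 (v, 0))) (at (snd e_chart e))"
    using diff_chain_at[OF pair smooth_on_has_derivative[OF sm z0, unfolded z0_def]]
    by (simp add: o_def D_def z0_def)
  have dD: "((\<lambda>x. D (x, y) w $ \<beta>) has_derivative (\<lambda>v. D2 w (v, 0) $ \<beta>)) (at (snd e_chart e))" for w \<beta>
  proof -
    have "((\<lambda>z. D z w) has_derivative D2 w) (at z0)"
      using smooth_on_has_derivative[OF smooth_on_directional[OF sm] z0] unfolding D_def D2_def .
    from diff_chain_at[OF pair this[unfolded z0_def]]
    have "((\<lambda>x. D (x, y) w) has_derivative (\<lambda>v. D2 w (v, 0))) (at (snd e_chart e))"
      by (simp add: o_def)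
    from bounded_linear.has_derivative[OF bounded_linear_vec_nth this] show ?thesis .
  qed
  have dPe: "(P_loc e_chart \<delta> \<epsilon> has_derivative dP_e \<delta> \<epsilon>) (at (snd e_chart e))" for \<delta> \<epsilon>
    unfolding dP_e_def by (rule smooth_on_has_derivative[OF smooth_on_P_loc[OF e_chart(1)] e_mem_image])
  have N0: "N z0 = y" unfolding N_def z0_def by (rule left_mult_e[OF y])
  have "(P_loc c \<beta> \<gamma> has_derivative frechet_derivative (P_loc c \<beta> \<gamma>) (at y)) (at (N (snd e_chart e, y)))"
    using smooth_on_has_derivative[OF smooth_on_P_loc[OF c] y] N0 by (simp add: z0_def)
  from diff_chain_at[OF dN this]
  have "((\<lambda>x. P_loc c \<beta> \<gamma> (N (x, y))) has_derivative
      (\<lambda>v. frechet_derivative (P_loc c \<beta> \<gamma>) (at y) (D z0 (v, 0)))) (at (snd e_chart e))"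
    by (simp add: o_def)
  \<comment> \<open>The same function is differentiated a second time, now through multiplicativity;
    uniqueness of the derivative equates the two results.\<close>
  moreover have "((\<lambda>x. P_loc c \<beta> \<gamma> (N (x, y))) has_derivative
      (\<lambda>v. (\<Sum>\<delta>\<in>UNIV. \<Sum>\<epsilon>\<in>UNIV. (D z0 (0, axis \<delta> 1) $ \<beta> * D2 (0, axis \<epsilon> 1) (v, 0) $ \<gamma>
              + D2 (0, axis \<delta> 1) (v, 0) $ \<beta> * D z0 (0, axis \<epsilon> 1) $ \<gamma>) * P_loc c \<delta> \<epsilon> y) +
        (\<Sum>\<delta>\<in>UNIV. \<Sum>\<epsilon>\<in>UNIV. D z0 (axis \<delta> 1, 0) $ \<beta> * D z0 (axis \<epsilon> 1, 0) $ \<gamma> * dP_e \<delta> \<epsilon> v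
           + (D z0 (axis \<delta> 1, 0) $ \<beta> * D2 (axis \<epsilon> 1, 0) (v, 0) $ \<gamma>
              + D2 (axis \<delta> 1, 0) (v, 0) $ \<beta> * D z0 (axis \<epsilon> 1, 0) $ \<gamma>) * P_loc e_chart \<delta> \<epsilon> (snd e_chart e))))
      (at (snd e_chart e))"
  proof (rule has_derivative_transform_within_open[OF _ \<open>open U\<close>])
    show "snd e_chart e \<in> U" using z0 by (simp add: U_def z0_def)
    show "(\<Sum>\<delta>\<in>UNIV. \<Sum>\<epsilon>\<in>UNIV. D (x, y) (0, axis \<delta> 1) $ \<beta> * D (x, y) (0, axis \<epsilon> 1) $ \<gamma> * P_loc c \<delta> \<epsilon> y) +
      (\<Sum>\<delta>\<in>UNIV. \<Sum>\<epsilon>\<in>UNIV. D (x, y) (axis \<delta> 1, 0) $ \<beta> * D (x, y) (axis \<epsilon> 1, 0) $ \<gamma> * P_loc e_chart \<delta> \<epsilon> x)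
      = P_loc c \<beta> \<gamma> (N (x, y))" if "x \<in> U" for x
      using P_loc_left_mult[OF c, of x y \<beta> \<gamma>] that by (simp add: U_def \<Omega>_def D_def N_def)
  qed (unfold z0_def, intro has_derivative_add has_derivative_sum has_derivative_mult has_derivative_mult_left dD dPe)
  ultimately have "(\<lambda>v. frechet_derivative (P_loc c \<beta> \<gamma>) (at y) (D z0 (v, 0))) =
      (\<lambda>v. (\<Sum>\<delta>\<in>UNIV. \<Sum>\<epsilon>\<in>UNIV. (D z0 (0, axis \<delta> 1) $ \<beta> * D2 (0, axis \<epsilon> 1) (v, 0) $ \<gamma>
              + D2 (0, axis \<delta> 1) (v, 0) $ \<beta> * D z0 (0, axis \<epsilon> 1) $ \<gamma>) * P_loc c \<delta> \<epsilon> y) +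
        (\<Sum>\<delta>\<in>UNIV. \<Sum>\<epsilon>\<in>UNIV. D z0 (axis \<delta> 1, 0) $ \<beta> * D z0 (axis \<epsilon> 1, 0) $ \<gamma> * dP_e \<delta> \<epsilon> v
           + (D z0 (axis \<delta> 1, 0) $ \<beta> * D2 (axis \<epsilon> 1, 0) (v, 0) $ \<gamma>
              + D2 (axis \<delta> 1, 0) (v, 0) $ \<beta> * D z0 (axis \<epsilon> 1, 0) $ \<gamma>) * P_loc e_chart \<delta> \<epsilon> (snd e_chart e)))"
    by (rule has_derivative_unique)
  from fun_cong[OF this, of Z]
  show ?thesis
    using frechet_derivative_left_mult_snd[OF c y] frechet_derivative_right_frame[OF c y, of _ Z]
    by (simp add: right_frame_def[symmetric] D_def D2_def N_def z0_def P_loc_e R_def)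
qed

section \<open>The intrinsic derivative and the dual bracket\<close>

definition linearization :: "real^'n \<Rightarrow> (real^'n) bivector" where
  "linearization Z \<xi> \<eta> = (\<Sum>\<delta>\<in>UNIV. \<Sum>\<epsilon>\<in>UNIV. dP_e \<delta> \<epsilon> Z * \<xi> (axis \<delta> 1) * \<eta> (axis \<epsilon> 1))"

text \<open>The terms of the Lie derivative that differentiate \<open>V\<close> carry a component of
  \<open>P e\<close>, which is zero, so only \<open>V e\<close> enters. The right-invariant field of
  \<open>Z\<close> makes the described bivector unique.\<close>

lemma intrinsic_derivative_eq: "intrinsic_derivative \<G> e P Z = linearization Z"
proof -
  have *: "lie_derivative_bivector \<G> V P e = linearization (V e)" for V
  proof (intro ext)
    fix \<xi> \<eta>
    have dy: "dy \<G> (chart_at \<G> e) e \<delta> (V e) = V e $ \<delta>" for \<delta>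
      using dy_apply[OF atlas e_chart(1,2)] e_chart(3) by (simp add: e_chart_def)
    have pd: "partial_deriv (chart_at \<G> e) \<delta> (bivector_comp \<G> P (chart_at \<G> e) \<beta> \<gamma>) e = dP_e \<beta> \<gamma> (axis \<delta> 1)" for \<beta> \<gamma> \<delta>
      by (simp add: partial_deriv_def dP_e_def P_loc_def e_chart_def)
    have 0: "bivector_comp \<G> P (chart_at \<G> e) \<beta> \<gamma> e = 0" for \<beta> \<gamma>
      by (simp add: bivector_comp_def P_e)
    show "lie_derivative_bivector \<G> V P e \<xi> \<eta> = linearization (V e) \<xi> \<eta>"
      unfolding lie_derivative_bivector_def linearization_def Let_def dy pd 0
      by (simp add: linear_axis_expansion[OF linear_dP_e, of _ _ "V e"])
  qed
  show ?thesis
    unfolding intrinsic_derivative_def *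
  proof (rule the_equality)
    show "B = linearization Z" if "\<forall>V. smooth_vector_field \<G> V \<and> V e = Z \<longrightarrow> linearization (V e) = B" for B
      using that[rule_format, of "\<lambda>q. right_to q Z"] smooth_vector_field_right_to by simp
  qed simp
qed

lemma dual_bracket_apply: "dual_bracket \<G> e P \<xi> \<eta> Z = linearization Z \<xi> \<eta>"
proof -
  have "linear (\<lambda>Z. linearization Z \<xi> \<eta>)"
    unfolding linearization_def
    by (intro linear_compose_sum ballI)
      (auto intro!: linearI simp: linear_add[OF linear_dP_e] linear_cmul[OF linear_dP_e] algebra_simps)
  then have "bounded_linear (\<lambda>Z. linearization Z \<xi> \<eta>)"
    by (simp add: linear_conv_bounded_linear)
  then show ?thesis
    by (simp add: dual_bracket_def intrinsic_derivative_eq bounded_linear_Blinfun_apply)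
qed

end

text \<open>Change of frame in a bilinear form \<open>K\<close>. Grouping the indices in pairs
  reduces the fourfold exchange to one \<open>sum.swap\<close>.\<close>

lemma bilinear_sum_rearrange:
  fixes K :: "'i::finite \<Rightarrow> 'j::finite \<Rightarrow> real" and r :: "'i \<Rightarrow> 'k::finite \<Rightarrow> real" and s :: "'j \<Rightarrow> 'l::finite \<Rightarrow> real"
  shows "(\<Sum>i\<in>UNIV. \<Sum>j\<in>UNIV. K i j * (\<Sum>k\<in>UNIV. a k * r i k) * (\<Sum>l\<in>UNIV. b l * s j l)) =
    (\<Sum>k\<in>UNIV. \<Sum>l\<in>UNIV. a k * b l * (\<Sum>i\<in>UNIV. \<Sum>j\<in>UNIV. r i k * s j l * K i j))"
proof -
  have "(\<Sum>i\<in>UNIV. \<Sum>j\<in>UNIV. K i j * (\<Sum>k\<in>UNIV. a k * r i k) * (\<Sum>l\<in>UNIV. b l * s j l)) =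
      (\<Sum>(i, j)\<in>UNIV \<times> UNIV. \<Sum>(k, l)\<in>UNIV \<times> UNIV. a k * b l * (r i k * s j l * K i j))"
    unfolding sum.cartesian_product[symmetric]
    by (simp add: sum_distrib_left sum_distrib_right sum_product mult_ac)
  also have "\<dots> = (\<Sum>z\<in>UNIV \<times> UNIV. \<Sum>w\<in>UNIV \<times> UNIV.
      a (fst z) * b (snd z) * (r (fst w) (fst z) * s (snd w) (snd z) * K (fst w) (snd w)))"
    unfolding case_prod_beta by (rule sum.swap)
  also have "\<dots> = (\<Sum>(k, l)\<in>UNIV \<times> UNIV. \<Sum>(i, j)\<in>UNIV \<times> UNIV. a k * b l * (r i k * s j l * K i j))"
    by (simp add: case_prod_beta)
  also have "\<dots> = (\<Sum>k\<in>UNIV. \<Sum>l\<in>UNIV. a k * b l * (\<Sum>i\<in>UNIV. \<Sum>j\<in>UNIV. r i k * s j l * K i j))"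
    unfolding sum.cartesian_product[symmetric] by (simp add: sum_distrib_left)
  finally show ?thesis .
qed

lemma covector_apply_coords:
  fixes \<A> :: "('m::topological_space, real^'n) chart set" and \<xi> :: "(real^'n) covector"
  assumes "smooth_atlas \<A>" "c \<in> \<A>" "q \<in> fst c"
  shows "\<xi> v = (\<Sum>\<beta>\<in>UNIV. \<xi> (tangent_of_coords \<A> c q (axis \<beta> 1)) * coords \<A> c q v $ \<beta>)"
  using arg_cong[OF covector_expansion_dy[OF assms, of \<xi>], of "\<lambda>\<zeta>. blinfun_apply \<zeta> v"]
  by (simp add: blinfun.sum_left blinfun.scaleR_left dy_apply[OF assms])

lemma covector_separates:
  fixes x y :: "real^'n"
  assumes "\<And>\<xi>::(real^'n) covector. \<xi> x = \<xi> y"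
  shows "x = y"
proof -
  have "x $ i = y $ i" for i
    using assms[of "Blinfun (\<lambda>x. x $ i)"] bounded_linear_Blinfun_apply[OF bounded_linear_vec_nth] by metis
  then show ?thesis by (simp add: vec_eq_iff)
qed

lemma dual_basis_expansion_covector:
  fixes T :: "'n \<Rightarrow> real^'n" and \<xi> :: "(real^'n) covector"
  assumes "basis_of_lie_algebra T"
  shows "(\<Sum>k\<in>UNIV. \<xi> (T k) *\<^sub>R dual_basis T k) = \<xi>"
proof -
  have "dual_basis T j (T k) = (if j = k then 1 else 0)" for j k
    using dual_basis_apply[OF assms, of j k] by auto
  from covector_coeffs_dual(2)[of "dual_basis T" T \<xi>, OF this] show ?thesis by simp
qed

lemma dual_basis_expansion_vector:
  assumes "basis_of_lie_algebra T"
  shows "(\<Sum>k\<in>UNIV. dual_basis T k w *\<^sub>R T k) = w"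
proof (rule covector_separates)
  fix \<xi> :: "(real^'a) covector"
  show "\<xi> (\<Sum>k\<in>UNIV. dual_basis T k w *\<^sub>R T k) = \<xi> w"
    using arg_cong[OF dual_basis_expansion_covector[OF assms, of \<xi>], of "\<lambda>\<zeta>. blinfun_apply \<zeta> w"]
    by (simp add: blinfun.sum_left blinfun.scaleR_left blinfun.sum_right blinfun.scaleR_right mult.commute)
qed

section \<open>Right-invariant components of the form A and the map Pi\<close>

context lie_group_in_charts
begin

lemma right_inv_form_eq: "right_inv_form \<G> gmult ginv \<xi> q = \<xi> o\<^sub>L right_from q"
  by (simp add: right_inv_form_def right_from_def)

lemma maurer_cartan_right_eq:
  assumes "basis_of_lie_algebra T"
  shows "maurer_cartan_right \<G> gmult ginv T q w = right_from q w"
  using dual_basis_expansion_vector[OF assms, of "right_from q w"]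
  by (simp add: maurer_cartan_right_def right_inv_form_eq)

text \<open>The right-invariant forms of the dual basis are dual to the vectors
  \<open>right_to (X p) (T k)\<close>, so the coefficients of \<open>A\<close> are its values on
  that frame.\<close>

lemma A_right_eq:
  assumes "basis_of_lie_algebra T"
  shows "A_right \<G> gmult ginv T X A k p v = A p v (right_to (X p) (T k))"
  unfolding A_right_def
  by (rule covector_coeffs_dual) (auto simp: right_inv_form_eq dual_basis_apply[OF assms])

lemma A_tilde_eq:
  assumes "basis_of_lie_algebra T"
  shows "A_tilde \<G> gmult ginv T X A p v = A p v o\<^sub>L right_to (X p)"
  using dual_basis_expansion_covector[OF assms, of "A p v o\<^sub>L right_to (X p)"]
  by (simp add: A_tilde_def A_right_eq[OF assms])

end

context poisson_lie_group_in_charts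
begin

lemma linearization_sum:
  "linearization Z (\<Sum>i\<in>UNIV. f i *\<^sub>R \<theta> i) (\<Sum>j\<in>UNIV. g j *\<^sub>R \<kappa> j)
    = (\<Sum>i\<in>(UNIV::'n set). \<Sum>j\<in>(UNIV::'n set). f i * g j * linearization Z (\<theta> i) (\<kappa> j))"
  using bilinear_sum_rearrange[of "\<lambda>\<delta> \<epsilon>. dP_e \<delta> \<epsilon> Z" f "\<lambda>\<delta> i. \<theta> i (axis \<delta> 1)" g "\<lambda>\<epsilon> j. \<kappa> j (axis \<epsilon> 1)"]
  by (simp add: linearization_def blinfun.sum_left blinfun.scaleR_left mult_ac)

text \<open>Each of the two terms of \<open>wedge\<close> collapses by bilinearity. The basis
  survives only inside \<open>A_tilde\<close>, and the wedge leaves just the antisymmetrization in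
  \<open>u\<close> and \<open>v\<close>.\<close>

lemma A_tilde_bracket_apply:
  assumes "basis_of_lie_algebra T"
  shows "A_tilde_bracket \<G> gmult e ginv P T X A p u v Z =
    linearization Z (A_tilde \<G> gmult ginv T X A p u) (A_tilde \<G> gmult ginv T X A p v) -
    linearization Z (A_tilde \<G> gmult ginv T X A p v) (A_tilde \<G> gmult ginv T X A p u)"
  unfolding A_tilde_bracket_def A_tilde_def linearization_sum
  by (simp add: blinfun.sum_left blinfun.scaleR_left dual_bracket_apply wedge_def left_diff_distrib sum_subtractf)

text \<open>Multiplicativity, differentiated at \<open>e\<close> along \<open>Z\<close>: the Lie derivative of \<open>P\<close> along the
  right-invariant field of \<open>Z\<close> is right-invariant. The vectors \<open>x\<^sub>u\<close> and \<open>x\<^sub>v\<close> absorb the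
  derivatives of that field.\<close>

lemma frechet_derivative_P_loc_contracted:
  fixes \<xi> \<eta> :: "(real^'n) covector" and Z
  assumes c: "c \<in> \<G>" and q: "q \<in> fst c"
  defines "a \<equiv> \<lambda>\<beta>. \<xi> (tangent_of_coords \<G> c q (axis \<beta> 1))"
    and "b \<equiv> \<lambda>\<beta>. \<eta> (tangent_of_coords \<G> c q (axis \<beta> 1))"
    and "R \<equiv> frechet_derivative (right_frame c Z) (at (snd c q))"
  assumes xu: "\<And>\<delta>. xu $ \<delta> = - (\<Sum>\<gamma>\<in>UNIV. P_loc c \<delta> \<gamma> (snd c q) * a \<gamma>)"
    and xv: "\<And>\<delta>. xv $ \<delta> = - (\<Sum>\<gamma>\<in>UNIV. P_loc c \<delta> \<gamma> (snd c q) * b \<gamma>)"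
  shows "(\<Sum>\<beta>\<in>UNIV. \<Sum>\<gamma>\<in>UNIV. a \<beta> * b \<gamma> *
        frechet_derivative (P_loc c \<beta> \<gamma>) (at (snd c q)) (right_frame c Z (snd c q)))
    = (\<Sum>\<gamma>\<in>UNIV. b \<gamma> * R xu $ \<gamma>) - (\<Sum>\<beta>\<in>UNIV. a \<beta> * R xv $ \<beta>)
      + linearization Z (\<xi> o\<^sub>L right_to q) (\<eta> o\<^sub>L right_to q)"
proof -
  define y where "y = snd c q"
  define p where "p \<delta> \<epsilon> = P_loc c \<delta> \<epsilon> y" for \<delta> \<epsilon>
  have y: "y \<in> snd c ` fst c" using q by (simp add: y_def)
  have antisym: "p \<delta> \<epsilon> = - p \<epsilon> \<delta>" for \<delta> \<epsilon>
    unfolding p_def y_def P_loc_chart[OF c q] by (rule P_antisym)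
  have "linear R"
    unfolding R_def by (rule linear_frechet_derivative)
      (rule smooth_on_differentiable[OF smooth_on_right_frame[OF c] y[unfolded y_def]])
  note R = linear_component_expansion[OF this]
  have axis_sum: "(\<Sum>\<delta>\<in>UNIV. axis \<delta> 1 $ \<beta> * F \<delta>) = F \<beta>" for F :: "'n \<Rightarrow> real" and \<beta>
    by (simp add: axis_def if_distrib[of "\<lambda>x. x * _"] cong: if_cong)
  have 1: "(\<Sum>\<delta>\<in>UNIV. \<Sum>\<epsilon>\<in>UNIV. axis \<delta> 1 $ \<beta> * R (axis \<epsilon> 1) $ \<gamma> * p \<delta> \<epsilon>)
      = (\<Sum>\<epsilon>\<in>UNIV. R (axis \<epsilon> 1) $ \<gamma> * p \<beta> \<epsilon>)" for \<beta> \<gamma>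
    using axis_sum[of \<beta> "\<lambda>\<delta>. \<Sum>\<epsilon>\<in>UNIV. R (axis \<epsilon> 1) $ \<gamma> * p \<delta> \<epsilon>"]
    by (simp add: sum_distrib_left mult.assoc)
  have 2: "(\<Sum>\<delta>\<in>UNIV. \<Sum>\<epsilon>\<in>UNIV. R (axis \<delta> 1) $ \<beta> * axis \<epsilon> 1 $ \<gamma> * p \<delta> \<epsilon>)
      = (\<Sum>\<delta>\<in>UNIV. R (axis \<delta> 1) $ \<beta> * p \<delta> \<gamma>)" for \<beta> \<gamma>
    using axis_sum[of \<gamma> "\<lambda>\<epsilon>. R (axis \<delta> 1) $ \<beta> * p \<delta> \<epsilon>" for \<delta>]
    by (simp add: mult.left_commute mult.assoc)
  \<comment> \<open>Antisymmetry moves the contraction to the first index and absorbs the minus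
    sign, whereas \<open>xv'\<close> keeps both. Hence the opposite signs in \<open>t1\<close> and
    \<open>t2\<close>.\<close>
  have xu': "xu $ \<epsilon> = (\<Sum>\<beta>\<in>UNIV. a \<beta> * p \<beta> \<epsilon>)" for \<epsilon>
    unfolding xu sum_negf[symmetric] y_def[symmetric] p_def[symmetric]
    by (rule sum.cong[OF refl], subst antisym) simp
  have xv': "xv $ \<delta> = - (\<Sum>\<gamma>\<in>UNIV. b \<gamma> * p \<delta> \<gamma>)" for \<delta>
    unfolding xv y_def[symmetric] p_def[symmetric] by (simp add: mult.commute)
  have t1: "(\<Sum>\<beta>\<in>UNIV. \<Sum>\<gamma>\<in>UNIV. a \<beta> * b \<gamma> * (\<Sum>\<epsilon>\<in>UNIV. R (axis \<epsilon> 1) $ \<gamma> * p \<beta> \<epsilon>))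
      = (\<Sum>\<gamma>\<in>UNIV. b \<gamma> * R xu $ \<gamma>)"
  proof -
    have "(\<Sum>\<beta>\<in>UNIV. \<Sum>\<gamma>\<in>UNIV. a \<beta> * b \<gamma> * (\<Sum>\<epsilon>\<in>UNIV. R (axis \<epsilon> 1) $ \<gamma> * p \<beta> \<epsilon>))
        = (\<Sum>\<gamma>\<in>UNIV. \<Sum>\<beta>\<in>UNIV. \<Sum>\<epsilon>\<in>UNIV. b \<gamma> * (R (axis \<epsilon> 1) $ \<gamma> * (a \<beta> * p \<beta> \<epsilon>)))"
      by (subst sum.swap) (simp add: sum_distrib_left mult_ac)
    also have "\<dots> = (\<Sum>\<gamma>\<in>UNIV. \<Sum>\<epsilon>\<in>UNIV. \<Sum>\<beta>\<in>UNIV. b \<gamma> * (R (axis \<epsilon> 1) $ \<gamma> * (a \<beta> * p \<beta> \<epsilon>)))"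
      by (rule sum.cong[OF refl]) (rule sum.swap)
    also have "\<dots> = (\<Sum>\<gamma>\<in>UNIV. b \<gamma> * R xu $ \<gamma>)"
      unfolding R[of xu] xu' by (simp add: sum_distrib_left)
    finally show ?thesis .
  qed
  have t2: "(\<Sum>\<beta>\<in>UNIV. \<Sum>\<gamma>\<in>UNIV. a \<beta> * b \<gamma> * (\<Sum>\<delta>\<in>UNIV. R (axis \<delta> 1) $ \<beta> * p \<delta> \<gamma>))
      = - (\<Sum>\<beta>\<in>UNIV. a \<beta> * R xv $ \<beta>)"
  proof -
    have "(\<Sum>\<beta>\<in>UNIV. \<Sum>\<gamma>\<in>UNIV. a \<beta> * b \<gamma> * (\<Sum>\<delta>\<in>UNIV. R (axis \<delta> 1) $ \<beta> * p \<delta> \<gamma>))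
        = (\<Sum>\<beta>\<in>UNIV. \<Sum>\<gamma>\<in>UNIV. \<Sum>\<delta>\<in>UNIV. a \<beta> * (R (axis \<delta> 1) $ \<beta> * (b \<gamma> * p \<delta> \<gamma>)))"
      by (simp add: sum_distrib_left mult_ac)
    also have "\<dots> = (\<Sum>\<beta>\<in>UNIV. \<Sum>\<delta>\<in>UNIV. \<Sum>\<gamma>\<in>UNIV. a \<beta> * (R (axis \<delta> 1) $ \<beta> * (b \<gamma> * p \<delta> \<gamma>)))"
      by (rule sum.cong[OF refl]) (rule sum.swap)
    also have "\<dots> = - (\<Sum>\<beta>\<in>UNIV. a \<beta> * R xv $ \<beta>)"
      unfolding R[of xv] xv' by (simp add: sum_distrib_left sum_negf)
    finally show ?thesis .
  qed
  have rt: "(\<xi> o\<^sub>L right_to q) (axis \<delta> 1) = (\<Sum>\<beta>\<in>UNIV. a \<beta> * right_frame c (axis \<delta> 1) y $ \<beta>)"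
    "(\<eta> o\<^sub>L right_to q) (axis \<delta> 1) = (\<Sum>\<beta>\<in>UNIV. b \<beta> * right_frame c (axis \<delta> 1) y $ \<beta>)" for \<delta>
    using covector_apply_coords[OF atlas c q, of _ "right_to q (axis \<delta> 1)"] coords_right_to[OF c q]
    by (simp_all add: a_def b_def y_def)
  have t3: "(\<Sum>\<beta>\<in>UNIV. \<Sum>\<gamma>\<in>UNIV. a \<beta> * b \<gamma> * (\<Sum>\<delta>\<in>UNIV. \<Sum>\<epsilon>\<in>UNIV.
      right_frame c (axis \<delta> 1) y $ \<beta> * right_frame c (axis \<epsilon> 1) y $ \<gamma> * dP_e \<delta> \<epsilon> Z))
     = linearization Z (\<xi> o\<^sub>L right_to q) (\<eta> o\<^sub>L right_to q)"
    unfolding linearization_def rt by (rule bilinear_sum_rearrange[symmetric])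
  have "frechet_derivative (P_loc c \<beta> \<gamma>) (at y) (right_frame c Z y) =
      (\<Sum>\<epsilon>\<in>UNIV. R (axis \<epsilon> 1) $ \<gamma> * p \<beta> \<epsilon>) + (\<Sum>\<delta>\<in>UNIV. R (axis \<delta> 1) $ \<beta> * p \<delta> \<gamma>) +
      (\<Sum>\<delta>\<in>UNIV. \<Sum>\<epsilon>\<in>UNIV. right_frame c (axis \<delta> 1) y $ \<beta> * right_frame c (axis \<epsilon> 1) y $ \<gamma> * dP_e \<delta> \<epsilon> Z)"
    for \<beta> \<gamma>
    unfolding frechet_derivative_P_loc_right_frame[OF c y] R_def[folded y_def, symmetric] p_def[symmetric]
    unfolding distrib_right sum.distrib 1 2 ..
  then show ?thesis
    unfolding y_def[symmetric]
    by (simp add: distrib_left sum.distrib t1 t2 t3)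
qed

text \<open>The right-hand side is linear in \<open>\<eta>\<close>, and in finite dimension such a
  functional is evaluation at a vector, assembled here from the coordinate functionals
  \<open>\<theta>\<close>. Covectors separate vectors, so the definite description in
  \<open>Pi_map\<close> is met exactly once.\<close>

lemma Pi_map_eq_iff:
  "Z = Pi_map \<G> gmult ginv P q \<xi> \<longleftrightarrow> (\<forall>\<eta>. blinfun_apply \<eta> Z = P q (\<xi> o\<^sub>L right_from q) (\<eta> o\<^sub>L right_from q))"
proof -
  define Q where "Q \<eta> = P q (\<xi> o\<^sub>L right_from q) (\<eta> o\<^sub>L right_from q)" for \<eta> :: "(real^'n) covector"
  have l: "linear (P q x)" for x
    using bilinear_P by (auto simp: bilinear_def)
  have Q_add: "Q (\<eta> + \<zeta>) = Q \<eta> + Q \<zeta>" for \<eta> \<zeta>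
    unfolding Q_def linear_add[OF l, symmetric] by (rule arg_cong[where f = "P q _"]) (rule blinfun_eqI, simp add: blinfun.add_left)
  have Q_scale: "Q (r *\<^sub>R \<eta>) = r * Q \<eta>" for \<eta> r
    unfolding Q_def linear_cmul[OF l, symmetric, simplified] by (rule arg_cong[where f = "P q _"]) (rule blinfun_eqI, simp add: blinfun.scaleR_left)
  have "linear Q" by (rule linearI) (simp_all add: Q_add Q_scale)
  define \<theta> :: "'n \<Rightarrow> (real^'n) covector" where "\<theta> i = Blinfun (\<lambda>x. x $ i)" for i
  have \<theta>: "\<theta> i x = x $ i" for i x
    unfolding \<theta>_def by (simp add: bounded_linear_Blinfun_apply[OF bounded_linear_vec_nth])
  have "\<eta> = (\<Sum>i\<in>UNIV. \<eta> (axis i 1) *\<^sub>R \<theta> i)" for \<eta> :: "(real^'n) covector"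
    by (rule covector_coeffs_dual) (simp add: \<theta> axis_def)
  then have Q_expand: "Q \<eta> = (\<Sum>i\<in>UNIV. \<eta> (axis i 1) * Q (\<theta> i))" for \<eta>
    using linear_sum[OF \<open>linear Q\<close>] by (metis (no_types, lifting) Q_scale sum.cong)
  have ex: "\<forall>\<eta>. blinfun_apply \<eta> (\<chi> i. Q (\<theta> i)) = Q \<eta>"
  proof
    fix \<eta> :: "(real^'n) covector"
    have "linear (blinfun_apply \<eta>)"
      by (simp add: blinfun.bounded_linear_right bounded_linear.linear)
    from linear_axis_expansion[OF this, of "\<chi> i. Q (\<theta> i)"]
    show "\<eta> (\<chi> i. Q (\<theta> i)) = Q \<eta>"
      by (subst Q_expand) (simp add: mult.commute)
  qed
  have uniq: "Z = Z'" if "\<forall>\<eta>. blinfun_apply \<eta> Z = Q \<eta>" "\<forall>\<eta>. blinfun_apply \<eta> Z' = Q \<eta>" for Z Z'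
    using that by (intro covector_separates) simp
  have "Pi_map \<G> gmult ginv P q \<xi> = (THE Z. \<forall>\<eta>. blinfun_apply \<eta> Z = Q \<eta>)"
    by (simp add: Pi_map_def right_inv_form_eq Q_def)
  also have "\<dots> = (\<chi> i. Q (\<theta> i))"
    by (rule the_equality[where P = "\<lambda>Z. \<forall>\<eta>. blinfun_apply \<eta> Z = Q \<eta>"]) (rule ex, rule uniq[OF _ ex])
  finally show ?thesis using ex uniq unfolding Q_def by metis
qed

end

section \<open>The fields of the sigma model and the first equation\<close>

locale sigma_model_fields = poisson_lie_group_in_charts \<G> gmult e ginv P
  for \<G> :: "('g::topological_space, real^'n) chart set"
    and gmult :: "'g \<Rightarrow> 'g \<Rightarrow> 'g" and e :: 'g and ginv :: "'g \<Rightarrow> 'g" and P :: "'g \<Rightarrow> (real^'n) bivector" +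
  fixes \<S> :: "('s::topological_space, 'e::euclidean_space) chart set"
    and X :: "'s \<Rightarrow> 'g" and A :: "'s \<Rightarrow> 'e \<Rightarrow> (real^'n) covector" and T :: "'n \<Rightarrow> real^'n"
  assumes smooth_S: "smooth_structure \<S>" and bundle_map: "vector_bundle_map \<S> \<G> X A"
    and basis: "basis_of_lie_algebra T"
begin

abbreviation "Atl \<equiv> A_tilde \<G> gmult ginv T X A"

lemma atlas_S: "smooth_atlas \<S>"
  using smooth_S by (simp add: smooth_structure_def)

lemma smooth_X: "smooth_map \<S> \<G> X"
  using bundle_map by (simp add: vector_bundle_map_def)

lemma A_local_eq:
  "c \<in> \<G> \<Longrightarrow> X p \<in> fst c \<Longrightarrow> A_local \<G> X A c \<alpha> p v = A p v (tangent_of_coords \<G> c (X p) (axis \<alpha> 1))"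
  by (simp add: A_local_def covector_coeffs_dy[OF atlas])

lemma dX_eq: "c \<in> \<G> \<Longrightarrow> X p \<in> fst c \<Longrightarrow> dX \<S> \<G> X c \<alpha> p v = coords \<G> c (X p) (tangent_map \<S> \<G> X p v) $ \<alpha>"
  by (simp add: dX_def dy_apply[OF atlas])

lemma first_equation_iff:
  assumes c: "c \<in> \<G>" "X p \<in> fst c"
  shows "maurer_cartan_pullback \<S> \<G> gmult ginv T X p v = Pi_map \<G> gmult ginv P (X p) (Atl p v)
    \<longleftrightarrow> (\<forall>\<alpha>. dX \<S> \<G> X c \<alpha> p v
          + (\<Sum>\<gamma>\<in>UNIV. bivector_comp \<G> P c \<alpha> \<gamma> (X p) * A_local \<G> X A c \<gamma> p v) = 0)"
proof -
  define w where "w = tangent_map \<S> \<G> X p v"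
  have l: "linear (P (X p) x)" for x
    using bilinear_P by (auto simp: bilinear_def)
  have A_back: "Atl p v o\<^sub>L right_from (X p) = A p v"
    by (rule blinfun_eqI) (simp add: A_tilde_eq[OF basis])
  have "maurer_cartan_pullback \<S> \<G> gmult ginv T X p v = Pi_map \<G> gmult ginv P (X p) (Atl p v)
    \<longleftrightarrow> (\<forall>\<eta>. blinfun_apply \<eta> (right_from (X p) w) = P (X p) (A p v) (\<eta> o\<^sub>L right_from (X p)))"
    by (simp add: maurer_cartan_pullback_def maurer_cartan_right_eq[OF basis] Pi_map_eq_iff A_back w_def)
  \<comment> \<open>Composition with \<open>right_to (X p)\<close> and with
    \<open>right_from (X p)\<close> are mutually inverse on covectors, so testing at
    \<open>e\<close> and testing at \<open>X p\<close> amount to the same.\<close>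
  also have "\<dots> \<longleftrightarrow> (\<forall>\<zeta>. blinfun_apply \<zeta> w = P (X p) (A p v) \<zeta>)"
  proof safe
    fix \<zeta> :: "(real^'n) covector"
    assume *: "\<forall>\<eta>. blinfun_apply \<eta> (right_from (X p) w) = P (X p) (A p v) (\<eta> o\<^sub>L right_from (X p))"
    have "(\<zeta> o\<^sub>L right_to (X p)) o\<^sub>L right_from (X p) = \<zeta>"
      by (rule blinfun_eqI) simp
    then show "\<zeta> w = P (X p) (A p v) \<zeta>"
      using *[rule_format, of "\<zeta> o\<^sub>L right_to (X p)"] by simp
  next
    fix \<eta> :: "(real^'n) covector"
    assume *: "\<forall>\<zeta>. blinfun_apply \<zeta> w = P (X p) (A p v) \<zeta>"
    show "\<eta> (right_from (X p) w) = P (X p) (A p v) (\<eta> o\<^sub>L right_from (X p))"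
      using *[rule_format, of "\<eta> o\<^sub>L right_from (X p)"] by simp
  qed
  also have "\<dots> \<longleftrightarrow> (\<forall>\<alpha>. dy \<G> c (X p) \<alpha> w = P (X p) (A p v) (dy \<G> c (X p) \<alpha>))"
  proof safe
    fix \<zeta> :: "(real^'n) covector"
    assume *: "\<forall>\<alpha>. dy \<G> c (X p) \<alpha> w = P (X p) (A p v) (dy \<G> c (X p) \<alpha>)"
    define z where "z k = \<zeta> (tangent_of_coords \<G> c (X p) (axis k 1))" for k
    have z: "\<zeta> = (\<Sum>k\<in>UNIV. z k *\<^sub>R dy \<G> c (X p) k)"
      unfolding z_def by (rule covector_expansion_dy[OF atlas c])
    show "\<zeta> w = P (X p) (A p v) \<zeta>"
      unfolding z linear_sum[OF l] linear_cmul[OF l] by (simp add: blinfun.sum_left blinfun.scaleR_left *)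
  qed simp
  also have "\<dots> \<longleftrightarrow> (\<forall>\<alpha>. dX \<S> \<G> X c \<alpha> p v
          + (\<Sum>\<gamma>\<in>UNIV. bivector_comp \<G> P c \<alpha> \<gamma> (X p) * A_local \<G> X A c \<gamma> p v) = 0)"
  proof -
    \<comment> \<open>\<open>Pi_map\<close> has \<open>A\<close> in the first slot of
      \<open>P\<close>, the local equation has it in the second. Antisymmetry accounts for the plus
      sign of the local equation.\<close>
    have neg: "P (X p) (A p v) (dy \<G> c (X p) \<alpha>) = - (\<Sum>\<gamma>\<in>UNIV. bivector_comp \<G> P c \<alpha> \<gamma> (X p) * A_local \<G> X A c \<gamma> p v)" for \<alpha>
    proof -
      have "P (X p) (A p v) (dy \<G> c (X p) \<alpha>) = - P (X p) (dy \<G> c (X p) \<alpha>) (A p v)" by (rule P_antisym)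
      also have "P (X p) (dy \<G> c (X p) \<alpha>) (A p v) = P (X p) (dy \<G> c (X p) \<alpha>) (\<Sum>\<gamma>\<in>UNIV. A_local \<G> X A c \<gamma> p v *\<^sub>R dy \<G> c (X p) \<gamma>)"
        using covector_expansion_dy[OF atlas c, of "A p v"] by (simp add: A_local_eq[OF c])
      also have "\<dots> = (\<Sum>\<gamma>\<in>UNIV. bivector_comp \<G> P c \<alpha> \<gamma> (X p) * A_local \<G> X A c \<gamma> p v)"
        unfolding linear_sum[OF l] linear_cmul[OF l] by (simp add: bivector_comp_def mult.commute)
      finally show ?thesis .
    qed
    show ?thesis unfolding dX_def w_def neg eq_neg_iff_add_eq_0 ..
  qed
  finally show ?thesis .
qed

end

subsection \<open>The equations of motion\<close>

context sigma_model_fields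
begin

section \<open>Chart expressions of the fields near a source point\<close>

context
  fixes p :: 's and c :: "('g, real^'n) chart"
  assumes c: "c \<in> \<G>" and Xp: "X p \<in> fst c"
begin

text \<open>The chart in which \<open>ext_deriv\<close> differentiates at \<open>p\<close>.\<close>

definition src_chart where "src_chart = chart_at \<S> p"

definition chart_overlap where "chart_overlap = snd src_chart ` (fst src_chart \<inter> X -` fst c)"

definition X_loc where "X_loc = snd c \<circ> X \<circ> chart_inv src_chart"

text \<open>The function \<open>\<omega>loc\<close> of \<open>ext_deriv\<close> for
  \<open>A_local\<close>: \<open>w\<close> is constant as a vector of components in
  \<open>src_chart\<close>, not as a stored tangent vector.\<close>

definition A_loc where
  "A_loc \<alpha> w x = A_local \<G> X A c \<alpha> (chart_inv src_chart x) (tangent_of_coords \<S> src_chart (chart_inv src_chart x) w)"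

lemma src_chart: "src_chart \<in> \<S>" "p \<in> fst src_chart"
  unfolding src_chart_def by (rule chart_at_mem[OF atlas_S], rule mem_chart_at[OF atlas_S])

lemma mem_chart_overlap: "snd src_chart p \<in> chart_overlap"
  using src_chart Xp by (auto simp: chart_overlap_def)

lemma open_chart_overlap: "open chart_overlap"
proof -
  have "continuous_on UNIV X" using smooth_X by (simp add: smooth_map_def)
  then have "open (X -` fst c)"
    using open_chart_domain[OF atlas c] by (simp add: continuous_on_open_vimage)
  then show ?thesis
    unfolding chart_overlap_def by (rule open_chart_image_Int[OF atlas_S src_chart(1)])
qed

lemma X_loc_at: "X_loc (snd src_chart p) = snd c (X p)"
  by (simp add: X_loc_def chart_inv_chart[OF atlas_S src_chart])

lemma X_loc_has_derivative:
  "(X_loc has_derivative (\<lambda>v. coords \<G> c (X p) (tangent_map \<S> \<G> X p v))) (at (snd src_chart p))"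
proof -
  have D: "(X_loc has_derivative frechet_derivative X_loc (at (snd src_chart p))) (at (snd src_chart p))"
    unfolding X_loc_def by (rule smooth_map_has_derivative[OF atlas_S atlas smooth_X src_chart c Xp])
  have "continuous_on UNIV X" using smooth_X by (simp add: smooth_map_def)
  from coords_tangent_map[OF atlas_S atlas this src_chart c Xp D[unfolded X_loc_def]]
  have "coords \<G> c (X p) (tangent_map \<S> \<G> X p v) = frechet_derivative X_loc (at (snd src_chart p)) v" for v
    using coords_chart_at[OF atlas_S, of p] by (simp add: X_loc_def src_chart_def)
  then show ?thesis using D by simp
qed

text \<open>The bundle map condition gives smoothness jointly in point and vector; freezing the
  vector and taking one component leaves \<open>A_loc\<close>.\<close>

lemma A_loc_has_derivative:
  "(A_loc \<alpha> w has_derivative frechet_derivative (A_loc \<alpha> w) (at (snd src_chart p))) (at (snd src_chart p))"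
proof -
  define F where "F = (\<lambda>(x, w). let p = chart_inv src_chart x
    in covector_coeffs (dy \<G> c (X p)) (A p (tangent_of_coords \<S> src_chart p w)))"
  have "smooth_on F (chart_overlap \<times> UNIV)"
    using bundle_map src_chart(1) c unfolding vector_bundle_map_def F_def chart_overlap_def by blast
  then have F: "(F has_derivative frechet_derivative F (at (snd src_chart p, w))) (at (snd src_chart p, w))"
    using smooth_on_has_derivative mem_chart_overlap by blast
  have "((\<lambda>x. (x, w)) has_derivative (\<lambda>v. (v, 0))) (at (snd src_chart p))"
    by (auto intro!: derivative_eq_intros)
  from bounded_linear.has_derivative[OF bounded_linear_vec_nth diff_chain_at[OF this F]]
  have "(\<lambda>x. (F \<circ> (\<lambda>x. (x, w))) x $ \<alpha>) differentiable (at (snd src_chart p))"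
    unfolding differentiable_def by blast
  moreover have "(\<lambda>x. (F \<circ> (\<lambda>x. (x, w))) x $ \<alpha>) = A_loc \<alpha> w"
    by (simp add: F_def A_loc_def A_local_def fun_eq_iff Let_def)
  ultimately show ?thesis by (simp add: frechet_derivative_works)
qed

lemma A_loc_at: "A_loc \<alpha> w (snd src_chart p) = A_local \<G> X A c \<alpha> p w"
  using tangent_of_coords_chart_at[OF atlas_S, of p]
  by (simp add: A_loc_def chart_inv_chart[OF atlas_S src_chart]) (simp add: src_chart_def)

lemma ext_deriv_A_local:
  "ext_deriv \<S> (A_local \<G> X A c \<alpha>) p u v =
    frechet_derivative (A_loc \<alpha> v) (at (snd src_chart p)) u - frechet_derivative (A_loc \<alpha> u) (at (snd src_chart p)) v"
  unfolding ext_deriv_def Let_def A_loc_def src_chart_def ..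

definition Atl_loc where
  "Atl_loc w x = Atl (chart_inv src_chart x) (tangent_of_coords \<S> src_chart (chart_inv src_chart x) w)"

text \<open>At a fixed \<open>Z\<close> the form splits into factors of known derivative, the
  components of \<open>A\<close> and the frame along \<open>X\<close>, ready for the product
  rule.\<close>

lemma Atl_loc_apply:
  assumes "x \<in> chart_overlap"
  shows "Atl_loc w x Z = (\<Sum>\<alpha>\<in>UNIV. A_loc \<alpha> w x * right_frame c Z (X_loc x) $ \<alpha>)"
proof -
  define r where "r = chart_inv src_chart x"
  have r: "X r \<in> fst c"
    using assms chart_inv_chart[OF atlas_S src_chart(1)] by (auto simp: chart_overlap_def r_def)
  have "Atl_loc w x Z = A r (tangent_of_coords \<S> src_chart r w) (right_to (X r) Z)"
    by (simp add: Atl_loc_def A_tilde_eq[OF basis] r_def)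
  also have "\<dots> = (\<Sum>\<alpha>\<in>UNIV. A_local \<G> X A c \<alpha> r (tangent_of_coords \<S> src_chart r w) * right_frame c Z (snd c (X r)) $ \<alpha>)"
    unfolding A_local_eq[OF c r] coords_right_to[OF c r, symmetric]
    by (rule covector_apply_coords[OF atlas c r])
  finally show ?thesis by (simp add: A_loc_def X_loc_def r_def)
qed

lemma Atl_loc_apply_has_derivative:
  "((\<lambda>x. Atl_loc w x Z) has_derivative (\<lambda>u. \<Sum>\<alpha>\<in>UNIV.
      A_local \<G> X A c \<alpha> p w * frechet_derivative (right_frame c Z) (at (snd c (X p)))
        (coords \<G> c (X p) (tangent_map \<S> \<G> X p u)) $ \<alpha> +
      frechet_derivative (A_loc \<alpha> w) (at (snd src_chart p)) u * right_frame c Z (snd c (X p)) $ \<alpha>)) (at (snd src_chart p))"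
proof (rule has_derivative_transform_within_open[OF _ open_chart_overlap mem_chart_overlap])
  have "snd c (X p) \<in> snd c ` fst c" using Xp by blast
  from smooth_on_has_derivative[OF smooth_on_right_frame[OF c] this]
  have "(right_frame c Z has_derivative frechet_derivative (right_frame c Z) (at (snd c (X p)))) (at (X_loc (snd src_chart p)))"
    by (simp add: X_loc_at)
  from bounded_linear.has_derivative[OF bounded_linear_vec_nth diff_chain_at[OF X_loc_has_derivative this]]
  have "((\<lambda>x. right_frame c Z (X_loc x) $ \<alpha>) has_derivative (\<lambda>u. frechet_derivative (right_frame c Z) (at (snd c (X p)))
        (coords \<G> c (X p) (tangent_map \<S> \<G> X p u)) $ \<alpha>)) (at (snd src_chart p))" for \<alpha>
    by (simp add: o_def)
  from has_derivative_sum[of UNIV, OF has_derivative_mult[OF A_loc_has_derivative[of _ w] this]]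
  show "((\<lambda>x. \<Sum>\<alpha>\<in>UNIV. A_loc \<alpha> w x * right_frame c Z (X_loc x) $ \<alpha>) has_derivative (\<lambda>u. \<Sum>\<alpha>\<in>UNIV.
      A_local \<G> X A c \<alpha> p w * frechet_derivative (right_frame c Z) (at (snd c (X p)))
        (coords \<G> c (X p) (tangent_map \<S> \<G> X p u)) $ \<alpha> +
      frechet_derivative (A_loc \<alpha> w) (at (snd src_chart p)) u * right_frame c Z (snd c (X p)) $ \<alpha>)) (at (snd src_chart p))"
    by (simp add: A_loc_at X_loc_at)
qed (simp add: Atl_loc_apply)

text \<open>Differentiability as a covector-valued map is reduced to evaluations on the basis \<open>T\<close>.\<close>

lemma Atl_loc_differentiable: "Atl_loc w differentiable (at (snd src_chart p))"
proof -
  have "(\<lambda>x. \<Sum>k\<in>UNIV. Atl_loc w x (T k) *\<^sub>R dual_basis T k) differentiable (at (snd src_chart p))"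
    unfolding differentiable_def
    by (rule exI, rule has_derivative_sum, rule has_derivative_scaleR_left, rule Atl_loc_apply_has_derivative)
  then show ?thesis by (simp add: dual_basis_expansion_covector[OF basis])
qed

text \<open>Evaluation at \<open>Z\<close> commutes with differentiation. After antisymmetrization
  the derivatives of \<open>A_loc\<close> form the exterior derivatives of the components; the
  derivatives of the frame along the image of \<open>X\<close> stay behind.\<close>

lemma ext_deriv_Atl_apply:
  "ext_deriv \<S> Atl p u v Z =
    (\<Sum>\<alpha>\<in>UNIV. ext_deriv \<S> (A_local \<G> X A c \<alpha>) p u v * right_frame c Z (snd c (X p)) $ \<alpha>) +
    (\<Sum>\<alpha>\<in>UNIV. A_local \<G> X A c \<alpha> p v * frechet_derivative (right_frame c Z) (at (snd c (X p)))
        (coords \<G> c (X p) (tangent_map \<S> \<G> X p u)) $ \<alpha>) -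
    (\<Sum>\<alpha>\<in>UNIV. A_local \<G> X A c \<alpha> p u * frechet_derivative (right_frame c Z) (at (snd c (X p)))
        (coords \<G> c (X p) (tangent_map \<S> \<G> X p v)) $ \<alpha>)"
proof -
  have L: "bounded_linear (\<lambda>\<xi>::(real^'n) covector. \<xi> Z)"
    by (rule blinfun.bounded_linear_left)
  have "frechet_derivative (Atl_loc w) (at (snd src_chart p)) u Z =
      (\<Sum>\<alpha>\<in>UNIV. A_local \<G> X A c \<alpha> p w * frechet_derivative (right_frame c Z) (at (snd c (X p)))
          (coords \<G> c (X p) (tangent_map \<S> \<G> X p u)) $ \<alpha>) +
      (\<Sum>\<alpha>\<in>UNIV. frechet_derivative (A_loc \<alpha> w) (at (snd src_chart p)) u * right_frame c Z (snd c (X p)) $ \<alpha>)" for u w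
    unfolding frechet_derivative_bounded_linear[OF L Atl_loc_differentiable, symmetric]
      frechet_derivative_at[OF Atl_loc_apply_has_derivative, symmetric]
    by (rule sum.distrib)
  moreover have "ext_deriv \<S> Atl p u v = frechet_derivative (Atl_loc v) (at (snd src_chart p)) u
      - frechet_derivative (Atl_loc u) (at (snd src_chart p)) v"
    unfolding ext_deriv_def Let_def Atl_loc_def src_chart_def ..
  ultimately show ?thesis
    by (simp add: blinfun.diff_left ext_deriv_A_local left_diff_distrib sum_subtractf)
qed

section \<open>Comparison of the second equations at a point\<close>

definition second_lhs where
  "second_lhs \<alpha> u v = ext_deriv \<S> (A_local \<G> X A c \<alpha>) p u v
    + 1/2 * (\<Sum>\<beta>\<in>UNIV. \<Sum>\<gamma>\<in>UNIV. partial_deriv c \<alpha> (bivector_comp \<G> P c \<beta> \<gamma>) (X p)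
        * wedge (A_local \<G> X A c \<beta>) (A_local \<G> X A c \<gamma>) p u v)"

lemma contracted_second_lhs:
  assumes eom1: "\<And>\<alpha> v. dX \<S> \<G> X c \<alpha> p v
          + (\<Sum>\<gamma>\<in>UNIV. bivector_comp \<G> P c \<alpha> \<gamma> (X p) * A_local \<G> X A c \<gamma> p v) = 0"
  shows "(ext_deriv \<S> Atl p u v + (1/2) *\<^sub>R A_tilde_bracket \<G> gmult e ginv P T X A p u v) Z
    = (\<Sum>\<alpha>\<in>UNIV. right_frame c Z (snd c (X p)) $ \<alpha> * second_lhs \<alpha> u v)"
proof -
  define y where "y = snd c (X p)"
  define R where "R = frechet_derivative (right_frame c Z) (at y)"
  define a where "a v \<beta> = A_local \<G> X A c \<beta> p v" for v \<beta>
  define dx where "dx v = coords \<G> c (X p) (tangent_map \<S> \<G> X p v)" for v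
  define dP where "dP \<beta> \<gamma> = frechet_derivative (P_loc c \<beta> \<gamma>) (at y)" for \<beta> \<gamma>
  define K where "K u v = (\<Sum>\<beta>\<in>UNIV. \<Sum>\<gamma>\<in>UNIV. a u \<beta> * a v \<gamma> * dP \<beta> \<gamma> (right_frame c Z y))" for u v
  define l where "l u v = linearization Z (Atl p u) (Atl p v)" for u v
  define B where "B u v = (\<Sum>\<gamma>\<in>UNIV. a v \<gamma> * R (dx u) $ \<gamma>)" for u v
  have a: "a v = (\<lambda>\<beta>. A p v (tangent_of_coords \<G> c (X p) (axis \<beta> 1)))" for v
    by (rule ext) (simp add: a_def A_local_eq[OF c Xp])
  have dx: "dx v $ \<delta> = - (\<Sum>\<gamma>\<in>UNIV. P_loc c \<delta> \<gamma> (snd c (X p)) * A p v (tangent_of_coords \<G> c (X p) (axis \<gamma> 1)))" for v \<delta>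
    using eom1[of \<delta> v] unfolding dX_eq[OF c Xp] A_local_eq[OF c Xp] dx_def P_loc_chart[OF c Xp] bivector_comp_def
    by (simp add: eq_neg_iff_add_eq_0)
  \<comment> \<open>By the first equation the velocities \<open>dx u\<close> and \<open>dx v\<close>
    are the vectors \<open>xu\<close> and \<open>xv\<close> of the contracted multiplicativity
    identity.\<close>
  have K: "K u v = B u v - B v u + l u v" for u v
    using frechet_derivative_P_loc_contracted[OF c Xp dx dx, of u v Z]
    unfolding K_def B_def l_def a dP_def R_def y_def A_tilde_eq[OF basis] .
  have lin: "linear (dP \<beta> \<gamma>)" for \<beta> \<gamma>
    unfolding dP_def
    by (rule linear_frechet_derivative, rule smooth_on_differentiable[OF smooth_on_P_loc[OF c]])
      (use Xp in \<open>simp add: y_def\<close>)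
  \<comment> \<open>Moving the sum over \<alpha> innermost assembles the partial derivatives into
    one directional derivative along the frame vector.\<close>
  have contr: "(\<Sum>\<alpha>\<in>UNIV. right_frame c Z y $ \<alpha> * (\<Sum>\<beta>\<in>UNIV. \<Sum>\<gamma>\<in>UNIV.
      partial_deriv c \<alpha> (bivector_comp \<G> P c \<beta> \<gamma>) (X p) * (a u \<beta> * a v \<gamma> - a v \<beta> * a u \<gamma>))) = K u v - K v u"
  proof -
    have "(\<Sum>\<alpha>\<in>UNIV. right_frame c Z y $ \<alpha> * (\<Sum>\<beta>\<in>UNIV. \<Sum>\<gamma>\<in>UNIV.
        partial_deriv c \<alpha> (bivector_comp \<G> P c \<beta> \<gamma>) (X p) * (a u \<beta> * a v \<gamma> - a v \<beta> * a u \<gamma>)))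
      = (\<Sum>\<alpha>\<in>UNIV. \<Sum>\<beta>\<in>UNIV. \<Sum>\<gamma>\<in>UNIV.
          (a u \<beta> * a v \<gamma> - a v \<beta> * a u \<gamma>) * (right_frame c Z y $ \<alpha> * dP \<beta> \<gamma> (axis \<alpha> 1)))"
      by (simp add: sum_distrib_left partial_deriv_def dP_def P_loc_def y_def mult_ac)
    also have "\<dots> = (\<Sum>\<beta>\<in>UNIV. \<Sum>\<alpha>\<in>UNIV. \<Sum>\<gamma>\<in>UNIV.
          (a u \<beta> * a v \<gamma> - a v \<beta> * a u \<gamma>) * (right_frame c Z y $ \<alpha> * dP \<beta> \<gamma> (axis \<alpha> 1)))"
      by (rule sum.swap)
    also have "\<dots> = (\<Sum>\<beta>\<in>UNIV. \<Sum>\<gamma>\<in>UNIV. \<Sum>\<alpha>\<in>UNIV.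
          (a u \<beta> * a v \<gamma> - a v \<beta> * a u \<gamma>) * (right_frame c Z y $ \<alpha> * dP \<beta> \<gamma> (axis \<alpha> 1)))"
      by (rule sum.cong[OF refl]) (rule sum.swap)
    also have "\<dots> = (\<Sum>\<beta>\<in>UNIV. \<Sum>\<gamma>\<in>UNIV. (a u \<beta> * a v \<gamma> - a v \<beta> * a u \<gamma>) * dP \<beta> \<gamma> (right_frame c Z y))"
      unfolding linear_axis_expansion[OF lin, of _ _ "right_frame c Z y"] by (simp add: sum_distrib_left)
    also have "\<dots> = K u v - K v u"
      by (simp add: K_def left_diff_distrib sum_subtractf)
    finally show ?thesis .
  qed
  have "(\<Sum>\<alpha>\<in>UNIV. right_frame c Z y $ \<alpha> * second_lhs \<alpha> u v)
      = (\<Sum>\<alpha>\<in>UNIV. right_frame c Z y $ \<alpha> * ext_deriv \<S> (A_local \<G> X A c \<alpha>) p u v) + 1/2 * (K u v - K v u)"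
    unfolding contr[symmetric] second_lhs_def wedge_def a_def
    by (simp add: distrib_left sum.distrib sum_distrib_left mult.left_commute)
  \<comment> \<open>Antisymmetrizing \<open>K\<close> counts \<open>B u v - B v u\<close> twice. The
    1/2 of the local equation reduces it to the single copy contained in the exterior derivative of
    \<open>A_tilde\<close> and leaves half of the bracket.\<close>
  also have "\<dots> = (\<Sum>\<alpha>\<in>UNIV. right_frame c Z y $ \<alpha> * ext_deriv \<S> (A_local \<G> X A c \<alpha>) p u v)
      + B u v - B v u + 1/2 * (l u v - l v u)"
    by (simp add: K algebra_simps)
  also have "\<dots> = (ext_deriv \<S> Atl p u v + (1/2) *\<^sub>R A_tilde_bracket \<G> gmult e ginv P T X A p u v) Z"
    by (simp add: blinfun.add_left blinfun.scaleR_left ext_deriv_Atl_apply A_tilde_bracket_apply[OF basis]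
        B_def l_def R_def y_def dx_def a_def mult.commute)
  finally show ?thesis by (simp add: y_def)
qed

lemma second_equation_iff:
  assumes eom1: "\<And>\<alpha> v. dX \<S> \<G> X c \<alpha> p v
          + (\<Sum>\<gamma>\<in>UNIV. bivector_comp \<G> P c \<alpha> \<gamma> (X p) * A_local \<G> X A c \<gamma> p v) = 0"
  shows "ext_deriv \<S> Atl p u v + (1/2) *\<^sub>R A_tilde_bracket \<G> gmult e ginv P T X A p u v = 0
    \<longleftrightarrow> (\<forall>\<alpha>. second_lhs \<alpha> u v = 0)"
proof
  assume *: "ext_deriv \<S> Atl p u v + (1/2) *\<^sub>R A_tilde_bracket \<G> gmult e ginv P T X A p u v = 0"
  show "\<forall>\<alpha>. second_lhs \<alpha> u v = 0"
  proof
    fix \<alpha>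
    \<comment> \<open>The Lie algebra element whose right-invariant field at \<open>X p\<close> is
      the \<alpha>-th coordinate vector, so that the contraction isolates one component.\<close>
    define Z where "Z = right_from (X p) (tangent_of_coords \<G> c (X p) (axis \<alpha> 1))"
    have "right_frame c Z (snd c (X p)) = axis \<alpha> 1"
      by (simp add: coords_right_to[OF c Xp, symmetric] Z_def coords_tangent_of_coords[OF atlas c Xp])
    then have "(\<Sum>\<beta>\<in>UNIV. axis \<alpha> 1 $ \<beta> * second_lhs \<beta> u v) = 0"
      using contracted_second_lhs[OF eom1, of u v Z] unfolding * by simp
    then show "second_lhs \<alpha> u v = 0"
      by (simp add: axis_def if_distrib[of "\<lambda>x. x * _"] cong: if_cong)
  qed
next
  assume "\<forall>\<alpha>. second_lhs \<alpha> u v = 0"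
  then show "ext_deriv \<S> Atl p u v + (1/2) *\<^sub>R A_tilde_bracket \<G> gmult e ginv P T X A p u v = 0"
    by (intro blinfun_eqI) (simp only: contracted_second_lhs[OF eom1] mult_zero_right sum.neutral_const blinfun.zero_left)
qed

end

text \<open>All the equations are pointwise. One direction samples the local equations in a single
  chart around each \<open>X p\<close>; the converse recovers them in every chart, the first
  equation before the second, whose comparison depends on it.\<close>

lemma equations_of_motion_iff:
  "equations_of_motion \<S> \<G> P X A \<longleftrightarrow>
    (\<forall>p v. maurer_cartan_pullback \<S> \<G> gmult ginv T X p v = Pi_map \<G> gmult ginv P (X p) (Atl p v)) \<and>
    (\<forall>p u v. ext_deriv \<S> Atl p u v + (1/2) *\<^sub>R A_tilde_bracket \<G> gmult e ginv P T X A p u v = 0)"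
proof
  assume L: "equations_of_motion \<S> \<G> P X A"
  have c: "chart_at \<G> (X p) \<in> \<G>" "X p \<in> fst (chart_at \<G> (X p))" for p
    by (rule chart_at_mem[OF atlas], rule mem_chart_at[OF atlas])
  have 1: "dX \<S> \<G> X (chart_at \<G> (X p)) \<alpha> p v
      + (\<Sum>\<gamma>\<in>UNIV. bivector_comp \<G> P (chart_at \<G> (X p)) \<alpha> \<gamma> (X p) * A_local \<G> X A (chart_at \<G> (X p)) \<gamma> p v) = 0"
    for p \<alpha> v
    using L c unfolding equations_of_motion_def by blast
  have 2: "second_lhs p (chart_at \<G> (X p)) \<alpha> u v = 0" for p \<alpha> u v
    using L c unfolding equations_of_motion_def second_lhs_def[OF c] by blast
  show "(\<forall>p v. maurer_cartan_pullback \<S> \<G> gmult ginv T X p v = Pi_map \<G> gmult ginv P (X p) (Atl p v)) \<and>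
    (\<forall>p u v. ext_deriv \<S> Atl p u v + (1/2) *\<^sub>R A_tilde_bracket \<G> gmult e ginv P T X A p u v = 0)"
    using first_equation_iff[OF c] second_equation_iff[OF c 1] 1 2 by simp
next
  assume R: "(\<forall>p v. maurer_cartan_pullback \<S> \<G> gmult ginv T X p v = Pi_map \<G> gmult ginv P (X p) (Atl p v)) \<and>
    (\<forall>p u v. ext_deriv \<S> Atl p u v + (1/2) *\<^sub>R A_tilde_bracket \<G> gmult e ginv P T X A p u v = 0)"
  show "equations_of_motion \<S> \<G> P X A"
    unfolding equations_of_motion_def
  proof (intro ballI allI conjI)
    fix c p \<alpha>
    assume "c \<in> \<G>" "p \<in> X -` fst c"
    then have c: "c \<in> \<G>" "X p \<in> fst c" by auto
    have 1: "dX \<S> \<G> X c \<alpha> p v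
      + (\<Sum>\<gamma>\<in>UNIV. bivector_comp \<G> P c \<alpha> \<gamma> (X p) * A_local \<G> X A c \<gamma> p v) = 0" for \<alpha> v
      using R first_equation_iff[OF c] by blast
    then show "dX \<S> \<G> X c \<alpha> p v
      + (\<Sum>\<gamma>\<in>UNIV. bivector_comp \<G> P c \<alpha> \<gamma> (X p) * A_local \<G> X A c \<gamma> p v) = 0" for v .
    show "ext_deriv \<S> (A_local \<G> X A c \<alpha>) p u v
          + 1/2 * (\<Sum>\<beta>\<in>UNIV. \<Sum>\<gamma>\<in>UNIV. partial_deriv c \<alpha> (bivector_comp \<G> P c \<beta> \<gamma>) (X p)
                    * wedge (A_local \<G> X A c \<beta>) (A_local \<G> X A c \<gamma>) p u v) = 0" for u v
      using R second_equation_iff[OF c 1, of u v] unfolding second_lhs_def[OF c] by blast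
  qed
qed

end

theorem proposition3p9:
  fixes \<G> :: "('g::{t2_space, second_countable_topology}, real^'n) chart set"
    and gmult :: "'g \<Rightarrow> 'g \<Rightarrow> 'g" and e :: 'g and ginv :: "'g \<Rightarrow> 'g"
    and P :: "'g \<Rightarrow> (real^'n) bivector"
    and \<S> :: "('s::{t2_space, second_countable_topology}, real^2) chart set"
    and X :: "'s \<Rightarrow> 'g"
    and A :: "'s \<Rightarrow> real^2 \<Rightarrow> (real^'n) covector"
    and T :: "'n \<Rightarrow> real^'n"
  assumes "poisson_lie_group \<G> gmult e ginv P"
    and "smooth_structure \<S>" and "orientable \<S>"
    and "vector_bundle_map \<S> \<G> X A"
    and "basis_of_lie_algebra T"
  shows "equations_of_motion \<S> \<G> P X A \<longleftrightarrow>
    (\<forall>p v. maurer_cartan_pullback \<S> \<G> gmult ginv T X p v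
           = Pi_map \<G> gmult ginv P (X p) (A_tilde \<G> gmult ginv T X A p v)) \<and>
    (\<forall>p u v. ext_deriv \<S> (A_tilde \<G> gmult ginv T X A) p u v
           + (1/2) *\<^sub>R A_tilde_bracket \<G> gmult e ginv P T X A p u v = 0)"
proof -
  have "lie_group \<G> gmult e ginv"
    using assms(1) by (simp add: poisson_lie_group_def)
  then interpret sigma_model_fields \<G> gmult e ginv P \<S> X A T
    by unfold_locales (use assms in auto)
  show ?thesis by (rule equations_of_motion_iff)
qed

end
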